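(* Let $\mathbb{F}$ be a field of characteristic zero and let $A,B\in M_n(\mathbb{F})$. The following statements are equivalent: (1) $\mathcal{C}(A)=\mathcal{C}(B)$; (2) there exist polynomials $f(x),g(x)\in\mathbb{F}[x]$ of degree at most $n-1$ such that $A=f(B)$ and $B=g(A)$; (3) there exists $P\in GL_{n^2}(\mathbb{F})$ such that $I_n\otimes A-A^T\otimes I_n=P\,(I_n\otimes B-B^T\otimes I_n)$; (4) there exist positive integers $k_1,k_2$ such that $\mathrm{Ker}\,\mathrm{ad}_A^{k_1}=\mathrm{Ann}_{k_1}(B)$ and $\mathrm{Ker}\,\mathrm{ad}_B^{k_2}=\mathrm{Ann}_{k_2}(A)$.
   Context: The centralizer of $A\in M_n(\mathbb{F})$ is $\mathcal{C}(A)=\{X\in M_n(\mathbb{F})\mid AX=XA\}$. $\otimes$ is the Kronecker product of matrices, $I_n$ the identity matrix, and $GL_{m}(\mathbb{F})$ the group of invertible $m\times m$ matrices. $\mathrm{ad}_A(X)=AX-XA$ for $X\in M_n(\mathbb{F})$, $\mathrm{ad}_A^k$ is its $k$-fold composition, $\mathrm{Ker}\,\mathrm{ad}_A^k=\{X\in M_n(\mathbb{F})\mid \mathrm{ad}_A^k(X)=O\}$, and the $k$-th annihilator of $B$ is $\mathrm{Ann}_k(B)=\{X\in M_n(\mathbb{F})\mid \mathrm{ad}_X^k(B)=O\}$. *)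

theory Defs
  imports
    "Jordan_Normal_Form.Matrix"
    "HOL-Computational_Algebra.Polynomial"
begin

definition mat_centralizer :: "nat \<Rightarrow> 'a::comm_ring_1 mat \<Rightarrow> 'a mat set" where
  "mat_centralizer n A = {X \<in> carrier_mat n n. A * X = X * A}"

definition mat_ad :: "'a::comm_ring_1 mat \<Rightarrow> 'a mat \<Rightarrow> 'a mat" where
  "mat_ad A X = A * X - X * A"

definition ker_mat_ad_pow :: "nat \<Rightarrow> nat \<Rightarrow> 'a::comm_ring_1 mat \<Rightarrow> 'a mat set" where
  "ker_mat_ad_pow n k A = {X \<in> carrier_mat n n. (mat_ad A ^^ k) X = 0\<^sub>m n n}"

definition mat_annihilator :: "nat \<Rightarrow> nat \<Rightarrow> 'a::comm_ring_1 mat \<Rightarrow> 'a mat set" where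
  "mat_annihilator n k B = {X \<in> carrier_mat n n. (mat_ad X ^^ k) B = 0\<^sub>m n n}"

text \<open>The matrix \<open>\<Sum>k\<le>degree p. coeff p k \<cdot> A ^ k\<close> for a square matrix \<open>A\<close>, where
  \<open>A ^ 0\<close> is the identity. The type of matrices of all sizes has no zero element, so the
  sum is taken in the module of matrices of the size of \<open>A\<close>.\<close>

definition mat_poly :: "'a::comm_ring_1 poly \<Rightarrow> 'a mat \<Rightarrow> 'a mat" where
  "mat_poly p A = finsum (module_mat TYPE('a) (dim_row A) (dim_row A))
     (\<lambda>k. coeff p k \<cdot>\<^sub>m (A ^\<^sub>m k)) {..degree p}"

text \<open>Block convention: block \<open>(i, j)\<close> of \<open>A \<otimes>\<^sub>k B\<close> is \<open>A $$ (i, j) \<cdot>\<^sub>m B\<close>.\<close>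

definition kronecker_product :: "'a::times mat \<Rightarrow> 'a mat \<Rightarrow> 'a mat"
    (infixl \<open>\<otimes>\<^sub>k\<close> 70) where
  "A \<otimes>\<^sub>k B = mat (dim_row A * dim_row B) (dim_col A * dim_col B)
     (\<lambda>(i, j). A $$ (i div dim_row B, j div dim_col B) * B $$ (i mod dim_row B, j mod dim_col B))"

end

theory Submission
  imports
    Defs
    "Jordan_Normal_Form.Jordan_Normal_Form_Existence"
    "Jordan_Normal_Form.DL_Rank"
    "HOL-Algebra.Algebraic_Closure_Type"
    "HOL-Library.Function_Algebras"
begin

text \<open>
  The centralizer of a matrix \<open>A\<close> is the kernel of \<open>ad\<^sub>A\<close>. Each of the three conditions is compared
  directly with equality of these kernels.

  Polynomials. A polynomial in \<open>B\<close> commutes with everything that commutes with \<open>B\<close>. The converse is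
  the double centralizer theorem (\<open>double_centralizer\<close>), proved here without any decomposition of
  the underlying module. Let \<open>m\<close> be the minimal polynomial of \<open>A\<close>, of degree \<open>d\<close>. The Bezoutian
  \<open>(m(x) - m(y)) / (x - y)\<close>, with \<open>x\<close> and \<open>y\<close> read as left and right multiplication by \<open>A\<close>, sends
  every matrix \<open>E\<close> to a matrix that commutes with \<open>A\<close>, hence with \<open>B\<close>. This is an identity between
  sums of terms \<open>B A\<^sup>j E A\<^sup>i\<close> and \<open>A\<^sup>j E A\<^sup>i B\<close> for all \<open>E\<close>. Contracting the right-hand factors with a linear
  functional that is \<open>1\<close> at \<open>A\<^sup>d\<^sup>-\<^sup>1\<close> and \<open>0\<close> at the lower powers leaves \<open>B\<close> on one side and a polynomial
  in \<open>A\<close> of degree below \<open>d\<close> on the other; \<open>d \<le> n\<close> by Cayley-Hamilton.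

  Kronecker products. The matrix \<open>I \<otimes> A - A\<^sup>T \<otimes> I\<close> represents \<open>ad\<^sub>A\<close> on column-stacked matrices
  (\<open>act_ad_mat\<close>), and two matrices of the same shape have the same kernel iff they differ by an
  invertible left factor (\<open>left_equivalent_iff_same_kernel\<close>).

  Annihilators. For exponent \<open>1\<close> both sides of the two equations are centralizers, so only
  exponents at least \<open>2\<close> need an argument. The point is that then \<open>A\<close> and \<open>B\<close> must be diagonalizable
  over the algebraic closure. Over that field write \<open>A = S + N\<close> in Jordan form and let \<open>h\<close> be the
  diagonal matrix, in the Jordan basis, with entries \<open>0, -1, -2, \<dots>\<close>. Then \<open>[h, A] = N\<close> commutes with
  \<open>A\<close>, so \<open>h\<close> lies in the kernel of \<open>ad\<^sub>A\<^sup>2\<close> and therefore in the annihilator of \<open>B\<close>; as \<open>h\<close> is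
  diagonalizable, it commutes with \<open>B\<close>. So \<open>h\<close> lies in the kernel of every power of \<open>ad\<^sub>B\<close>, hence
  in the annihilator of \<open>A\<close>, and in the same way it commutes with \<open>A\<close>; thus \<open>N = 0\<close>
  (\<open>semisimple_of_kernels_in_annihilators\<close>). Once \<open>A\<close> is diagonalizable, the kernel of \<open>ad\<^sub>A\<^sup>k\<close> is the
  centralizer of \<open>A\<close>, and it contains the centralizer of \<open>B\<close> because the annihilator of \<open>B\<close> does.
  The inclusion of a kernel in an annihilator passes to the algebraic closure
  (\<open>kernel_in_annihilator_alg_closure\<close>): the kernel is spanned by its rational points, and the
  annihilator is given by polynomial equations, which persist because the base field is infinite.
\<close>

\<comment> \<open>\<open>degree\<close> and \<open>coeff\<close> stand for the operations on the type of polynomials.\<close>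
hide_const (open) Polynomials.degree Polynomials.lead_coeff up_ring.coeff up_ring.monom

section \<open>Polynomials in a matrix\<close>

lemma index_mult_mat_sum:
  assumes "A \<in> carrier_mat n m" "B \<in> carrier_mat m l" "i < n" "j < l"
  shows "(A * B) $$ (i,j) = (\<Sum>k<m. A $$ (i,k) * B $$ (k,j))"
  using assms by (auto simp: scalar_prod_def lessThan_atLeast0)

lemma mat_poly_carrier [simp]:
  assumes "A \<in> carrier_mat n n"
  shows "mat_poly p A \<in> carrier_mat n n"
proof -
  interpret abelian_group "module_mat TYPE('a) n n" by (rule abelian_group_mat)
  show ?thesis
    using finsum_closed[of "\<lambda>k. coeff p k \<cdot>\<^sub>m (A ^\<^sub>m k)" "{..degree p}"] assms
    by (simp add: mat_poly_def Pi_def pow_carrier_mat module_mat_simps)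
qed

lemma index_mat_poly:
  assumes A: "A \<in> carrier_mat n n" and "i < n" "j < n" and N: "degree p \<le> N"
  shows "mat_poly p A $$ (i,j) = (\<Sum>k\<le>N. coeff p k * (A ^\<^sub>m k) $$ (i,j))"
proof -
  interpret abelian_group "module_mat TYPE('a) n n" by (rule abelian_group_mat)
  let ?f = "\<lambda>k. coeff p k \<cdot>\<^sub>m (A ^\<^sub>m k)"
  have f: "?f k \<in> carrier_mat n n" for k
    using A by (simp add: pow_carrier_mat)
  have P: "A ^\<^sub>m k \<in> carrier_mat n n" for k
    using A by (simp add: pow_carrier_mat)
  have "finsum (module_mat TYPE('a) n n) ?f K $$ (i,j) = (\<Sum>k\<in>K. coeff p k * (A ^\<^sub>m k) $$ (i,j))
    \<and> finsum (module_mat TYPE('a) n n) ?f K \<in> carrier_mat n n" if "finite K" for K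
    using that
  proof (induction K)
    case empty
    show ?case using assms finsum_empty[of ?f] by (simp add: module_mat_simps)
  next
    case (insert k K)
    have "finsum (module_mat TYPE('a) n n) ?f (insert k K)
        = ?f k + finsum (module_mat TYPE('a) n n) ?f K"
      using finsum_insert[of K k ?f] insert.hyps f by (simp add: module_mat_simps Pi_def)
    then show ?case
      using insert f[of k] P[of k] assms by (auto simp: carrier_matD[OF P])
  qed
  from this[of "{..degree p}"] have "mat_poly p A $$ (i,j) = (\<Sum>k\<le>degree p. coeff p k * (A ^\<^sub>m k) $$ (i,j))"
    using A by (simp add: mat_poly_def)
  also have "\<dots> = (\<Sum>k\<le>N. coeff p k * (A ^\<^sub>m k) $$ (i,j))"
    using N by (intro sum.mono_neutral_left) (auto simp: coeff_eq_0)
  finally show ?thesis .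
qed

lemma commute_mat_poly:
  assumes A: "A \<in> carrier_mat n n" and Y: "Y \<in> carrier_mat n n" and AY: "A * Y = Y * A"
  shows "mat_poly p A * Y = Y * mat_poly p A"
proof (rule eq_matI)
  have P: "A ^\<^sub>m k \<in> carrier_mat n n" for k
    using A by (simp add: pow_carrier_mat)
  have comm: "A ^\<^sub>m k * Y = Y * A ^\<^sub>m k" for k
  proof (induction k)
    case (Suc k)
    have "A ^\<^sub>m Suc k * Y = A ^\<^sub>m k * (Y * A)"
      using assoc_mult_mat[OF P[of k] A Y] by (simp add: AY)
    also have "\<dots> = Y * A ^\<^sub>m Suc k"
      using assoc_mult_mat[OF P[of k] Y A] assoc_mult_mat[OF Y P[of k] A] Suc.IH by simp
    finally show ?case .
  qed (use A Y in simp)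
  fix i j assume "i < dim_row (Y * mat_poly p A)" "j < dim_col (Y * mat_poly p A)"
  then have ij: "i < n" "j < n" using A Y mat_poly_carrier[OF A, of p] by auto
  let ?c = "coeff p"
  have "(mat_poly p A * Y) $$ (i,j) = (\<Sum>l<n. \<Sum>k\<le>degree p. ?c k * ((A ^\<^sub>m k) $$ (i,l) * Y $$ (l,j)))"
    unfolding index_mult_mat_sum[OF mat_poly_carrier[OF A] Y ij]
    using ij by (intro sum.cong refl) (simp add: index_mat_poly[OF A _ _ order.refl] sum_distrib_right mult.assoc)
  also have "\<dots> = (\<Sum>k\<le>degree p. ?c k * (A ^\<^sub>m k * Y) $$ (i,j))"
    unfolding index_mult_mat_sum[OF P Y ij] by (subst sum.swap) (simp add: sum_distrib_left)
  also have "\<dots> = (\<Sum>k\<le>degree p. ?c k * (Y * A ^\<^sub>m k) $$ (i,j))"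
    by (simp only: comm)
  also have "\<dots> = (\<Sum>l<n. \<Sum>k\<le>degree p. Y $$ (i,l) * (?c k * (A ^\<^sub>m k) $$ (l,j)))"
    unfolding index_mult_mat_sum[OF Y P ij] sum_distrib_left by (subst sum.swap) (simp add: mult_ac)
  also have "\<dots> = (Y * mat_poly p A) $$ (i,j)"
    unfolding index_mult_mat_sum[OF Y mat_poly_carrier[OF A] ij]
    using ij by (intro sum.cong refl) (simp add: index_mat_poly[OF A _ _ order.refl] sum_distrib_left)
  finally show "(mat_poly p A * Y) $$ (i,j) = (Y * mat_poly p A) $$ (i,j)" .
qed (use A Y carrier_matD[OF mat_poly_carrier[OF A, of p]] in auto)

lemma mat_poly_zero:
  assumes "A \<in> carrier_mat n n" "i < n" "j < n"
  shows "mat_poly 0 A $$ (i,j) = 0"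
  using index_mat_poly[OF assms, of 0 0] by simp

lemma mat_poly_add:
  assumes "A \<in> carrier_mat n n" "i < n" "j < n"
  shows "mat_poly (p + q) A $$ (i,j) = mat_poly p A $$ (i,j) + mat_poly q A $$ (i,j)"
proof -
  let ?N = "max (degree p) (degree q)"
  have "degree (p + q) \<le> ?N" by (rule degree_add_le_max)
  then show ?thesis
    using index_mat_poly[OF assms, of _ ?N] by (simp add: sum.distrib distrib_right)
qed

lemma mat_poly_sum:
  assumes "A \<in> carrier_mat n n" "i < n" "j < n"
  shows "mat_poly (\<Sum>k\<in>K. f k) A $$ (i,j) = (\<Sum>k\<in>K. mat_poly (f k) A $$ (i,j))"
  by (induction K rule: infinite_finite_induct)
     (simp_all add: mat_poly_zero[OF assms] mat_poly_add[OF assms])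

lemma mat_poly_smult:
  assumes "A \<in> carrier_mat n n" "i < n" "j < n"
  shows "mat_poly (smult c p) A $$ (i,j) = c * mat_poly p A $$ (i,j)"
  using index_mat_poly[OF assms, of _ "degree p"]
  by (simp add: degree_smult_le sum_distrib_left mult.assoc)

lemma mat_poly_mult_X:
  assumes A: "A \<in> carrier_mat n n" and ij: "i < n" "j < n"
  shows "mat_poly (p * [:0, 1:]) A $$ (i,j) = (\<Sum>l<n. A $$ (i,l) * mat_poly p A $$ (l,j))"
proof -
  have P: "A ^\<^sub>m k \<in> carrier_mat n n" for k
    using A by (simp add: pow_carrier_mat)
  have suc: "A ^\<^sub>m Suc k = A * A ^\<^sub>m k" for k
  proof (induction k)
    case (Suc k)
    then show ?case using assoc_mult_mat[OF A P[of k] A] by simp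
  qed (use A in simp)
  have "degree (p * [:0, 1:]) \<le> Suc (degree p)"
    using degree_mult_le[of p "[:0,1:]"] by simp
  then have "mat_poly (p * [:0, 1:]) A $$ (i,j)
      = (\<Sum>k\<le>Suc (degree p). coeff (p * [:0, 1:]) k * (A ^\<^sub>m k) $$ (i,j))"
    by (rule index_mat_poly[OF A ij])
  also have "\<dots> = (\<Sum>k\<le>degree p. coeff p k * (A ^\<^sub>m Suc k) $$ (i,j))"
    by (subst sum.atMost_Suc_shift) simp
  also have "\<dots> = (\<Sum>k\<le>degree p. \<Sum>l<n. A $$ (i,l) * (coeff p k * (A ^\<^sub>m k) $$ (l,j)))"
    unfolding suc index_mult_mat_sum[OF A P ij] by (simp add: sum_distrib_left mult_ac)
  also have "\<dots> = (\<Sum>l<n. A $$ (i,l) * mat_poly p A $$ (l,j))"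
    using ij by (subst sum.swap) (simp add: index_mat_poly[OF A _ _ order.refl] sum_distrib_left)
  finally show ?thesis .
qed

text \<open>
  The adjugate \<open>N\<close> of \<open>C = x I - A\<close> satisfies \<open>N C = \<chi> I\<close> over the polynomial ring. Substitute
  \<open>A\<close> for \<open>x\<close> in the entry \<open>(i,l)\<close> of \<open>N C\<close>, take row \<open>l\<close> of the resulting matrix, and add up over
  \<open>l\<close>. Read off from \<open>\<chi> I\<close> this is row \<open>i\<close> of \<open>\<chi>(A)\<close>; expanding the product \<open>N C\<close> instead, everything
  cancels, because row \<open>k\<close> of \<open>A p(A)\<close> is the combination of the rows \<open>l\<close> of \<open>p(A)\<close> with coefficients
  \<open>A\<^sub>k\<^sub>l\<close>.
\<close>

lemma Cayley_Hamilton_entries: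
  fixes A :: "'a :: comm_ring_1 mat"
  assumes A: "A \<in> carrier_mat n n" and ij: "i < n" "j < n"
  shows "mat_poly (char_poly A) A $$ (i,j) = 0"
proof -
  define C where "C = char_poly_matrix A"
  have C: "C \<in> carrier_mat n n" using A by (simp add: C_def)
  define N where "N = adj_mat C"
  have N: "N \<in> carrier_mat n n" using adj_mat(1)[OF C] by (simp add: N_def)
  have NC: "N * C = char_poly A \<cdot>\<^sub>m 1\<^sub>m n"
    using adj_mat(3)[OF C] by (simp add: N_def C_def char_poly_def)
  have Ckl: "C $$ (k,l) = (if k = l then [:0,1:] else 0) + [: - A $$ (k,l) :]" if "k < n" "l < n" for k l
    using that A by (auto simp: C_def char_poly_matrix_def)
  have *: "(\<Sum>k<n. N $$ (i,k) * C $$ (k,l)) = (if i = l then char_poly A else 0)" if "l < n" for l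
    using index_mult_mat_sum[OF N C ij(1) that, symmetric] that ij by (simp add: NC)
  have NCe: "mat_poly (N $$ (i,k) * C $$ (k,l)) A $$ (l,j)
      = (if k = l then mat_poly (N $$ (i,k) * [:0,1:]) A $$ (k,j) else 0)
         - A $$ (k,l) * mat_poly (N $$ (i,k)) A $$ (l,j)" if "k < n" "l < n" for k l
  proof -
    have NC_kl: "N $$ (i,k) * C $$ (k,l) = (if k = l then N $$ (i,k) * [:0,1:] else 0) + smult (- A $$ (k,l)) (N $$ (i,k))"
      using that by (simp add: Ckl distrib_left del: smult_minus_left)
    show ?thesis
      unfolding NC_kl using that ij
      by (simp add: mat_poly_add[OF A] mat_poly_smult[OF A] mat_poly_zero[OF A]
          del: mult_pCons_right smult_minus_left)
  qed
  have "mat_poly (char_poly A) A $$ (i,j) = (\<Sum>l<n. mat_poly (if i = l then char_poly A else 0) A $$ (l,j))"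
    using ij by (simp add: mat_poly_zero[OF A] if_distrib[of "\<lambda>p. mat_poly p A $$ _"] cong: if_cong)
  also have "\<dots> = (\<Sum>l<n. \<Sum>k<n. mat_poly (N $$ (i,k) * C $$ (k,l)) A $$ (l,j))"
    using ij by (intro sum.cong refl) (simp flip: * add: mat_poly_sum[OF A])
  also have "\<dots> = (\<Sum>k<n. \<Sum>l<n. (if k = l then mat_poly (N $$ (i,k) * [:0,1:]) A $$ (k,j) else 0)
         - A $$ (k,l) * mat_poly (N $$ (i,k)) A $$ (l,j))"
    by (subst sum.swap) (simp add: NCe del: mult_pCons_right)
  also have "\<dots> = (\<Sum>k<n. mat_poly (N $$ (i,k) * [:0,1:]) A $$ (k,j)
         - (\<Sum>l<n. A $$ (k,l) * mat_poly (N $$ (i,k)) A $$ (l,j)))"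
    by (intro sum.cong refl) (simp add: sum_subtractf del: mult_pCons_right)
  also have "\<dots> = 0"
    using ij by (intro sum.neutral ballI) (simp add: mat_poly_mult_X[OF A] del: mult_pCons_right)
  finally show ?thesis .
qed

section \<open>A double centralizer theorem\<close>

text \<open>
  Linear algebra over an arbitrary field is done in the space of all functions from an index
  type, which forms a type and so a model of the locale of vector spaces; matrices and vectors are
  embedded there by extending them with zeros.
\<close>

definition scale_fun :: "'a::field \<Rightarrow> ('i \<Rightarrow> 'a) \<Rightarrow> 'i \<Rightarrow> 'a" where
  "scale_fun c f = (\<lambda>i. c * f i)"

interpretation fun_space: vector_space scale_fun
  by unfold_locales (auto simp: scale_fun_def fun_eq_iff algebra_simps)

lemma vector_space_pair_dual: "vector_space_pair scale_fun ((*) :: 'a::field \<Rightarrow> 'a \<Rightarrow> 'a)"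
  by unfold_locales (auto simp: algebra_simps)

lemma separating_functional:
  fixes w :: "'i \<Rightarrow> 'b::field"
  assumes "w \<notin> fun_space.span U"
  obtains f where "Vector_Spaces.linear scale_fun (*) f" "f w = 1" "\<And>u. u \<in> U \<Longrightarrow> f u = 0"
proof -
  interpret dual: vector_space_pair scale_fun "(*) :: 'b \<Rightarrow> 'b \<Rightarrow> 'b"
    by (rule vector_space_pair_dual)
  obtain C where C: "C \<subseteq> U" "fun_space.independent C" "U \<subseteq> fun_space.span C"
    using fun_space.maximal_independent_subset[of U] by blast
  have "w \<notin> fun_space.span C"
    using assms C(1) fun_space.span_mono[of C U] by blast
  then have "fun_space.independent (insert w C)" and wC: "w \<notin> C"
    using C(2) fun_space.independent_insertI fun_space.span_base by blast+
  then obtain f where f: "Vector_Spaces.linear scale_fun (*) f"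
    "\<And>x. x \<in> insert w C \<Longrightarrow> f x = (if x = w then 1 else 0)"
    using dual.linear_independent_extend[of "insert w C" "\<lambda>x. if x = w then 1 else 0"] by blast
  have f0: "f x = 0" if "x \<in> C" for x
    using f(2)[of x] that wC by auto
  have "f u = 0" if "u \<in> U" for u
    using dual.linear_eq_0_on_span[OF f(1) f0, of C u] C(3) that by auto
  then show ?thesis using that f by simp
qed

lemma span_image_lessThan:
  assumes "u \<in> fun_space.span (v ` {..<d :: nat})"
  shows "\<exists>c. u = (\<Sum>k<d. scale_fun (c k) (v k))"
proof -
  let ?W = "range (\<lambda>c. \<Sum>k<d. scale_fun (c k) (v k))"
  have "fun_space.subspace ?W"
  proof (rule fun_space.subspaceI)
    show "0 \<in> ?W" by (rule range_eqI[of _ _ "\<lambda>_. 0"]) simp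
  next
    fix x y assume "x \<in> ?W" "y \<in> ?W"
    then obtain c c' where "x = (\<Sum>k<d. scale_fun (c k) (v k))" "y = (\<Sum>k<d. scale_fun (c' k) (v k))"
      by auto
    then show "x + y \<in> ?W"
      by (intro range_eqI[of _ _ "\<lambda>k. c k + c' k"]) (simp add: sum.distrib fun_space.scale_left_distrib)
  next
    fix a x assume "x \<in> ?W"
    then obtain c where "x = (\<Sum>k<d. scale_fun (c k) (v k))"
      by auto
    then show "scale_fun a x \<in> ?W"
      by (intro range_eqI[of _ _ "\<lambda>k. a * c k"]) (simp add: fun_space.scale_sum_right)
  qed
  moreover have "v ` {..<d} \<subseteq> ?W"
  proof
    fix x assume "x \<in> v ` {..<d}"
    then obtain l where l: "l < d" "x = v l" by auto
    then have "x = (\<Sum>k<d. scale_fun (if k = l then 1 else 0) (v k))"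
      by (subst sum.remove[of _ l]) (auto intro!: sum.neutral)
    then show "x \<in> ?W" by (intro range_eqI[of _ _ "\<lambda>k. if k = l then 1 else 0"])
  qed
  ultimately show ?thesis using assms fun_space.span_minimal by blast
qed

definition entries :: "nat \<Rightarrow> 'a::zero mat \<Rightarrow> nat \<times> nat \<Rightarrow> 'a" where
  "entries n M = (\<lambda>(i,j). if i < n \<and> j < n then M $$ (i,j) else 0)"

lemma sum_fun_apply: "(\<Sum>k\<in>K. f k) x = (\<Sum>k\<in>K. f k x :: 'a :: comm_monoid_add)"
  by (induction K rule: infinite_finite_induct) auto

text \<open>
  The coefficients are the values at the elementary matrices, so a functional on matrices is
  \<open>M \<mapsto> tr (R M)\<close> for a fixed matrix \<open>R\<close>.
\<close>

lemma linear_functional_entries: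
  fixes f :: "(nat \<times> nat \<Rightarrow> 'a::field) \<Rightarrow> 'a"
  assumes f: "Vector_Spaces.linear scale_fun (*) f"
  obtains r where "\<And>M. f (entries n M) = (\<Sum>i<n. \<Sum>j<n. M $$ (i,j) * r i j)"
proof
  fix M :: "'a mat"
  let ?e = "\<lambda>i j p. if p = (i,j) then 1 else 0 :: 'a"
  have entries_eq: "entries n M = (\<Sum>i<n. \<Sum>j<n. scale_fun (M $$ (i,j)) (?e i j))"
  proof
    fix p :: "nat \<times> nat"
    obtain k l where p: "p = (k,l)" by fastforce
    have "(\<Sum>i<n. \<Sum>j<n. scale_fun (M $$ (i,j)) (?e i j)) p
        = (\<Sum>i<n. \<Sum>j<n. M $$ (i,j) * ?e i j p)"
      by (simp add: sum_fun_apply scale_fun_def)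
    also have "\<dots> = (\<Sum>i<n. if k = i then \<Sum>j<n. if j = l then M $$ (i,j) else 0 else 0)"
      by (rule sum.cong, rule refl) (auto simp: p if_distrib[of "\<lambda>z. _ * z"] cong: if_cong)
    also have "\<dots> = (if k < n then \<Sum>j<n. if j = l then M $$ (k,j) else 0 else 0)"
      by (subst sum.delta') simp_all
    also have "\<dots> = entries n M p" by (simp add: entries_def p)
    finally show "entries n M p = (\<Sum>i<n. \<Sum>j<n. scale_fun (M $$ (i,j)) (?e i j)) p" ..
  qed
  interpret dual: vector_space_pair scale_fun "(*) :: 'a \<Rightarrow> 'a \<Rightarrow> 'a"
    by (rule vector_space_pair_dual)
  show "f (entries n M) = (\<Sum>i<n. \<Sum>j<n. M $$ (i,j) * f (?e i j))"
    by (simp add: entries_eq dual.linear_sum[OF f] dual.linear_scale[OF f])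
qed

lemma pow_mat_Suc_left:
  assumes A: "A \<in> carrier_mat n n"
  shows "A ^\<^sub>m Suc k = A * A ^\<^sub>m k"
proof (induction k)
  case (Suc k)
  then show ?case using assoc_mult_mat[OF A pow_carrier_mat[OF A] A, of k] by simp
qed (use A in simp)

lemma mat_poly_monom:
  assumes A: "A \<in> carrier_mat n n" and "i < n" "j < n"
  shows "mat_poly (monom c k) A $$ (i,j) = c * (A ^\<^sub>m k) $$ (i,j)"
  unfolding index_mat_poly[OF assms degree_monom_le]
  by (subst sum.remove[of _ k]) (auto intro!: sum.neutral)

lemma sum_swap_dependent:
  fixes d n :: nat
  shows "(\<Sum>y<n. \<Sum>k\<le>d. \<Sum>i<k. f y k i) = (\<Sum>k\<le>d. \<Sum>i<k. \<Sum>y<n. f y k i)"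
proof -
  have "(\<Sum>y<n. \<Sum>k\<le>d. \<Sum>i<k. f y k i) = (\<Sum>k\<le>d. \<Sum>y<n. \<Sum>i<k. f y k i)"
    by (rule sum.swap)
  also have "\<dots> = (\<Sum>k\<le>d. \<Sum>i<k. \<Sum>y<n. f y k i)"
    by (rule sum.cong, rule refl, rule sum.swap)
  finally show ?thesis .
qed

text \<open>
  With \<open>m(x) = \<Sum>k\<le>d. m k * x\<^sup>k\<close> this is the value at the elementary matrix \<open>E\<^sub>a\<^sub>b\<close> of the operator
  obtained from \<open>(m(x) - m(y)) / (x - y)\<close> by reading \<open>x\<close> as left and \<open>y\<close> as right multiplication by
  \<open>A\<close>; the entry \<open>(x,c)\<close> of \<open>A\<^sup>j E\<^sub>a\<^sub>b A\<^sup>i\<close> is the product of two entries of powers of \<open>A\<close>.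
\<close>

definition bezoutian :: "nat \<Rightarrow> 'a::comm_ring_1 mat \<Rightarrow> nat \<Rightarrow> (nat \<Rightarrow> 'a) \<Rightarrow> nat \<Rightarrow> nat \<Rightarrow> 'a mat" where
  "bezoutian n A d m a b = mat n n (\<lambda>(x,c). \<Sum>k\<le>d. m k *
     (\<Sum>i<k. (A ^\<^sub>m (k - Suc i)) $$ (x,a) * (A ^\<^sub>m i) $$ (b,c)))"

lemma bezoutian_carrier [simp]: "bezoutian n A d m a b \<in> carrier_mat n n"
  by (simp add: bezoutian_def)

lemma index_mult_bezoutian:
  assumes A: "A \<in> carrier_mat n n" and B: "B \<in> carrier_mat n n"
    and xc: "x < n" "c < n" and ab: "a < n" "b < n"
  shows "(B * bezoutian n A d m a b) $$ (x,c) = (\<Sum>k\<le>d. m k *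
      (\<Sum>i<k. (B * A ^\<^sub>m (k - Suc i)) $$ (x,a) * (A ^\<^sub>m i) $$ (b,c)))"
  unfolding index_mult_mat_sum[OF B bezoutian_carrier xc]
    index_mult_mat_sum[OF B pow_carrier_mat[OF A] xc(1) ab(1)] using xc
  by (simp add: bezoutian_def sum_distrib_left sum_distrib_right mult_ac sum_swap_dependent)

lemma index_bezoutian_mult:
  assumes A: "A \<in> carrier_mat n n" and B: "B \<in> carrier_mat n n"
    and xc: "x < n" "c < n" and ab: "a < n" "b < n"
  shows "(bezoutian n A d m a b * B) $$ (x,c) = (\<Sum>k\<le>d. m k *
      (\<Sum>i<k. (A ^\<^sub>m (k - Suc i)) $$ (x,a) * (A ^\<^sub>m i * B) $$ (b,c)))"
  unfolding index_mult_mat_sum[OF bezoutian_carrier B xc]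
    index_mult_mat_sum[OF pow_carrier_mat[OF A] B ab(2) xc(2)] using xc
  by (simp add: bezoutian_def sum_distrib_left sum_distrib_right mult_ac sum_swap_dependent)

text \<open>
  Multiplying \<open>(m(x) - m(y)) / (x - y)\<close> by \<open>x - y\<close> gives \<open>m(x) - m(y)\<close>, which acts as zero because
  \<open>m\<close> annihilates \<open>A\<close>; at the level of entries the inner sum telescopes.
\<close>

lemma bezoutian_commutes:
  fixes A :: "'a::comm_ring_1 mat"
  assumes A: "A \<in> carrier_mat n n" and ab: "a < n" "b < n"
    and rel: "\<And>x y. x < n \<Longrightarrow> y < n \<Longrightarrow> (\<Sum>k\<le>d. m k * (A ^\<^sub>m k) $$ (x,y)) = 0"
  shows "A * bezoutian n A d m a b = bezoutian n A d m a b * A" (is "A * ?\<Phi> = ?\<Phi> * A")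
proof (rule eq_matI)
  fix x c assume "x < dim_row (?\<Phi> * A)" "c < dim_col (?\<Phi> * A)"
  then have xc: "x < n" "c < n" using A by (auto simp: bezoutian_def)
  let ?h = "\<lambda>k i. (A ^\<^sub>m (k - i)) $$ (x,a) * (A ^\<^sub>m i) $$ (b,c)"
  have "(A * ?\<Phi>) $$ (x,c) = (\<Sum>k\<le>d. m k * (\<Sum>i<k. ?h k i))"
    unfolding index_mult_bezoutian[OF A A xc ab] pow_mat_Suc_left[OF A, symmetric]
    by (intro sum.cong arg_cong2[of _ _ _ _ "(*)"] refl) (simp_all add: Suc_diff_Suc del: pow_mat.simps)
  moreover have "(?\<Phi> * A) $$ (x,c) = (\<Sum>k\<le>d. m k * (\<Sum>i<k. ?h k (Suc i)))"
    unfolding index_bezoutian_mult[OF A A xc ab] by simp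
  ultimately have "(A * ?\<Phi>) $$ (x,c) - (?\<Phi> * A) $$ (x,c) = (\<Sum>k\<le>d. m k * (\<Sum>i<k. ?h k i - ?h k (Suc i)))"
    by (simp add: sum_subtractf right_diff_distrib)
  also have "\<dots> = (\<Sum>k\<le>d. m k * (?h k 0 - ?h k k))"
    using sum_lessThan_telescope'[of "?h k" k for k] by simp
  also have "\<dots> = (\<Sum>k\<le>d. m k * (A ^\<^sub>m k) $$ (x,a)) * (A ^\<^sub>m 0) $$ (b,c)
      - (A ^\<^sub>m 0) $$ (x,a) * (\<Sum>k\<le>d. m k * (A ^\<^sub>m k) $$ (b,c))"
    by (simp add: sum_distrib_left sum_distrib_right right_diff_distrib sum_subtractf mult_ac)
  also have "\<dots> = 0"
    using rel xc ab by simp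
  finally show "(A * ?\<Phi>) $$ (x,c) = (?\<Phi> * A) $$ (x,c)" by simp
qed (use A in \<open>auto simp: bezoutian_def\<close>)

text \<open>
  The coefficients \<open>m\<close> are those of the minimal polynomial, found as the first linear dependency
  among the powers of \<open>A\<close>. The last conclusion is what makes a functional separating \<open>A\<^sup>d\<^sup>-\<^sup>1\<close> from the
  lower powers available.
\<close>

lemma minimal_relation:
  fixes A :: "'a::field mat"
  assumes A: "A \<in> carrier_mat n n" and n: "n \<ge> 1"
  obtains d m where "d \<le> n" "d \<ge> 1" "m d = 1"
    "\<And>i j. i < n \<Longrightarrow> j < n \<Longrightarrow> (\<Sum>k\<le>d. m k * (A ^\<^sub>m k) $$ (i,j)) = 0"
    "entries n (A ^\<^sub>m (d - 1)) \<notin> fun_space.span ((\<lambda>k. entries n (A ^\<^sub>m k)) ` {..<d - 1})"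
proof -
  let ?v = "\<lambda>k. entries n (A ^\<^sub>m k)"
  define Q where "Q d \<longleftrightarrow> ?v d \<in> fun_space.span (?v ` {..<d})" for d
  have deg: "degree (char_poly A) = n" "coeff (char_poly A) n = 1"
    using degree_monic_char_poly[OF A] by auto
  have vn: "?v n = (\<Sum>k<n. scale_fun (- coeff (char_poly A) k) (?v k))"
  proof
    fix p :: "nat \<times> nat"
    obtain i j where p: "p = (i,j)" by fastforce
    show "?v n p = (\<Sum>k<n. scale_fun (- coeff (char_poly A) k) (?v k)) p"
    proof (cases "i < n \<and> j < n")
      case True
      then have "(\<Sum>k\<le>n. coeff (char_poly A) k * (A ^\<^sub>m k) $$ (i,j)) = 0"
        using Cayley_Hamilton_entries[OF A] index_mat_poly[OF A, of i j "char_poly A" n] deg by simp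
      then have "(A ^\<^sub>m n) $$ (i,j) = - (\<Sum>k<n. coeff (char_poly A) k * (A ^\<^sub>m k) $$ (i,j))"
        using deg(2) by (simp add: lessThan_Suc_atMost[symmetric] eq_neg_iff_add_eq_0 add.commute)
      then show ?thesis
        using True by (simp add: p sum_fun_apply scale_fun_def entries_def sum_negf)
    qed (auto simp: p sum_fun_apply scale_fun_def entries_def)
  qed
  have "?v k \<in> fun_space.span (?v ` {..<n})" if "k < n" for k
    using that by (auto intro: fun_space.span_base)
  then have "Q n"
    unfolding Q_def by (subst vn) (intro fun_space.span_sum fun_space.span_scale, simp)
  define d where "d = (LEAST d. Q d)"
  have Qd: "Q d" and dn: "d \<le> n"
    unfolding d_def using \<open>Q n\<close> by (auto intro: LeastI Least_le)
  \<comment> \<open>\<open>n > 0\<close> enters here: the identity matrix is not zero\<close>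
  have "\<not> Q 0"
  proof
    assume "Q 0"
    then have "?v 0 (0,0) = 0" by (simp add: Q_def)
    then show False using n A by (simp add: entries_def)
  qed
  then have d1: "d \<ge> 1" using Qd by (cases d) auto
  then have "\<not> Q (d - 1)"
    unfolding d_def using not_less_Least[of "d - 1" Q] by (simp add: d_def)
  obtain c where c: "?v d = (\<Sum>k<d. scale_fun (c k) (?v k))"
    using span_image_lessThan[of "?v d" ?v d] Qd unfolding Q_def by blast
  let ?m = "\<lambda>k. if k = d then 1 else - c k"
  have "(\<Sum>k\<le>d. ?m k * (A ^\<^sub>m k) $$ (i,j)) = 0" if "i < n" "j < n" for i j
    using fun_cong[OF c, of "(i,j)"] that
    by (simp add: lessThan_Suc_atMost[symmetric] entries_def sum_fun_apply scale_fun_def sum_negf)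
  then show ?thesis
    using that[of d ?m] dn d1 \<open>\<not> Q (d - 1)\<close> unfolding Q_def by simp
qed

text \<open>
  \<open>B\<close> commutes with the Bezoutian applied to every elementary matrix \<open>E\<^sub>a\<^sub>b\<close>. Comparing the entries
  \<open>(x,c)\<close>, the index pair \<open>(b,c)\<close> occurs only in the right-hand factors \<open>A\<^sup>i\<close> and \<open>A\<^sup>i B\<close>, and can be contracted
  with the functional \<open>\<tau>\<close>. Since \<open>\<tau> (A\<^sup>i)\<close> vanishes for \<open>i < d - 1\<close>, only the term \<open>k = d\<close>,
  \<open>i = d - 1\<close> survives on the left, and it equals \<open>B\<close>; the right side is a polynomial in \<open>A\<close> with
  coefficients \<open>m k * \<tau> (A\<^sup>i B)\<close>.
\<close>

theorem double_centralizer: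
  fixes A B :: "'a::field mat"
  assumes A: "A \<in> carrier_mat n n" and B: "B \<in> carrier_mat n n" and n: "n \<ge> 1"
    and comm: "\<And>Y. Y \<in> carrier_mat n n \<Longrightarrow> A * Y = Y * A \<Longrightarrow> B * Y = Y * B"
  shows "\<exists>f. degree f \<le> n - 1 \<and> B = mat_poly f A"
proof -
  obtain d m where dn: "d \<le> n" and d1: "d \<ge> 1" and md: "m d = 1" and
    rel: "\<And>i j. i < n \<Longrightarrow> j < n \<Longrightarrow> (\<Sum>k\<le>d. m k * (A ^\<^sub>m k) $$ (i,j)) = 0" and
    indep: "entries n (A ^\<^sub>m (d - 1)) \<notin> fun_space.span ((\<lambda>k. entries n (A ^\<^sub>m k)) ` {..<d - 1})"
    using minimal_relation[OF A n] by blast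
  obtain f where f: "Vector_Spaces.linear scale_fun (*) f" "f (entries n (A ^\<^sub>m (d - 1))) = 1"
    "\<And>k. k < d - 1 \<Longrightarrow> f (entries n (A ^\<^sub>m k)) = 0"
    using separating_functional[OF indep] by (metis (no_types, lifting) imageI lessThan_iff)
  obtain r where r: "\<And>M. f (entries n M) = (\<Sum>i<n. \<Sum>j<n. M $$ (i,j) * r i j)"
    using linear_functional_entries[OF f(1)] by blast
  define \<tau> where "\<tau> M = (\<Sum>i<n. \<Sum>j<n. M $$ (i,j) * r i j)" for M
  have \<tau>: "\<tau> (A ^\<^sub>m k) = (if k = d - 1 then 1 else 0)" if "k < d" for k
    using f(2) f(3)[of k] that d1 by (auto simp: r \<tau>_def)
  have P: "A ^\<^sub>m k \<in> carrier_mat n n" for k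
    using A by (simp add: pow_carrier_mat)
  have key: "(\<Sum>k\<le>d. m k * (\<Sum>i<k. (B * A ^\<^sub>m (k - Suc i)) $$ (x,a) * (A ^\<^sub>m i) $$ (b,c)))
      = (\<Sum>k\<le>d. m k * (\<Sum>i<k. (A ^\<^sub>m (k - Suc i)) $$ (x,a) * (A ^\<^sub>m i * B) $$ (b,c)))"
    if ab: "a < n" "b < n" and xc: "x < n" "c < n" for x a b c
  proof -
    let ?\<Phi> = "bezoutian n A d m a b"
    have "B * ?\<Phi> = ?\<Phi> * B"
      using bezoutian_commutes[OF A ab rel] by (intro comm) simp_all
    then show ?thesis
      using index_mult_bezoutian[OF A B xc ab, of d m] index_bezoutian_mult[OF A B xc ab, of d m]
      by (simp only:)
  qed
  have contract: "(\<Sum>b<n. \<Sum>c<n. (\<Sum>k\<le>d. m k * (\<Sum>i<k. g k i * M i $$ (b,c))) * r b c)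
      = (\<Sum>k\<le>d. m k * (\<Sum>i<k. g k i * \<tau> (M i)))" for g :: "nat \<Rightarrow> nat \<Rightarrow> 'a" and M
  proof -
    have "(\<Sum>b<n. \<Sum>c<n. (\<Sum>k\<le>d. m k * (\<Sum>i<k. g k i * M i $$ (b,c))) * r b c)
       = (\<Sum>b<n. \<Sum>c<n. \<Sum>k\<le>d. \<Sum>i<k. m k * (g k i * (M i $$ (b,c) * r b c)))"
      by (simp add: sum_distrib_left sum_distrib_right mult.assoc)
    also have "\<dots> = (\<Sum>k\<le>d. \<Sum>i<k. \<Sum>b<n. \<Sum>c<n. m k * (g k i * (M i $$ (b,c) * r b c)))"
      by (simp only: sum_swap_dependent)
    finally show ?thesis by (simp add: \<tau>_def sum_distrib_left)
  qed
  define p where "p = (\<Sum>k\<le>d. \<Sum>i<k. monom (m k * \<tau> (A ^\<^sub>m i * B)) (k - Suc i))"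
  have "degree (monom c (k - Suc i)) \<le> n - 1" if "k \<le> d" for c :: 'a and k i
    using that dn by (intro order.trans[OF degree_monom_le]) auto
  then have "degree p \<le> n - 1"
    unfolding p_def by (intro degree_sum_le) auto
  moreover have "B = mat_poly p A"
  proof (rule eq_matI)
    fix x a assume "x < dim_row (mat_poly p A)" "a < dim_col (mat_poly p A)"
    then have xa: "x < n" "a < n" using carrier_matD[OF mat_poly_carrier[OF A, of p]] by auto
    have "(\<Sum>k\<le>d. m k * (\<Sum>i<k. (B * A ^\<^sub>m (k - Suc i)) $$ (x,a) * \<tau> (A ^\<^sub>m i)))
      = (\<Sum>k\<le>d. m k * (\<Sum>i<k. (A ^\<^sub>m (k - Suc i)) $$ (x,a) * \<tau> (A ^\<^sub>m i * B)))"
      unfolding contract[symmetric] using xa by (intro sum.cong refl) (simp add: key)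
    also have "\<dots> = mat_poly p A $$ (x,a)"
      using xa by (simp add: p_def mat_poly_sum[OF A] mat_poly_monom[OF A] sum_distrib_left mult_ac)
    also have "(\<Sum>k\<le>d. m k * (\<Sum>i<k. (B * A ^\<^sub>m (k - Suc i)) $$ (x,a) * \<tau> (A ^\<^sub>m i)))
      = (\<Sum>k\<le>d. if k = d then B $$ (x,a) else 0)"
    proof (intro sum.cong refl)
      fix k assume k: "k \<in> {..d}"
      have "(\<Sum>i<k. (B * A ^\<^sub>m (k - Suc i)) $$ (x,a) * \<tau> (A ^\<^sub>m i))
         = (\<Sum>i<k. if i = d - 1 then (B * A ^\<^sub>m (k - Suc i)) $$ (x,a) else 0)"
        using k by (intro sum.cong refl) (simp add: \<tau>)
      also have "\<dots> = (if k = d then B $$ (x,a) else 0)"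
        using k d1 A B by auto
      finally show "m k * (\<Sum>i<k. (B * A ^\<^sub>m (k - Suc i)) $$ (x,a) * \<tau> (A ^\<^sub>m i))
        = (if k = d then B $$ (x,a) else 0)" by (simp add: md)
    qed
    finally show "B $$ (x,a) = mat_poly p A $$ (x,a)" by simp
  qed (use B carrier_matD[OF mat_poly_carrier[OF A, of p]] in auto)
  ultimately show ?thesis by blast
qed

lemma centralizer_eq_iff_mutual_polys:
  fixes A B :: "'a::field mat"
  assumes A: "A \<in> carrier_mat n n" and B: "B \<in> carrier_mat n n" and n: "n \<ge> 1"
  shows "mat_centralizer n A = mat_centralizer n B \<longleftrightarrow>
       (\<exists>f g :: 'a poly. degree f \<le> n - 1 \<and> degree g \<le> n - 1 \<and>
          A = mat_poly f B \<and> B = mat_poly g A)"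
proof
  assume "mat_centralizer n A = mat_centralizer n B"
  then have "A * Y = Y * A \<longleftrightarrow> B * Y = Y * B" if "Y \<in> carrier_mat n n" for Y
    using that by (auto simp: mat_centralizer_def)
  then show "\<exists>f g :: 'a poly. degree f \<le> n - 1 \<and> degree g \<le> n - 1 \<and>
          A = mat_poly f B \<and> B = mat_poly g A"
    using double_centralizer[OF A B n] double_centralizer[OF B A n] by blast
next
  assume "\<exists>f g :: 'a poly. degree f \<le> n - 1 \<and> degree g \<le> n - 1 \<and>
          A = mat_poly f B \<and> B = mat_poly g A"
  then obtain f g where f: "mat_poly f B = A" and g: "mat_poly g A = B"
    by metis
  have "B * Y = Y * B" if "Y \<in> carrier_mat n n" "A * Y = Y * A" for Y
    using commute_mat_poly[OF A that, of g] unfolding g .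
  moreover have "A * Y = Y * A" if "Y \<in> carrier_mat n n" "B * Y = Y * B" for Y
    using commute_mat_poly[OF B that, of f] unfolding f .
  ultimately show "mat_centralizer n A = mat_centralizer n B"
    by (auto simp: mat_centralizer_def)
qed

section \<open>Matrices with the same kernel\<close>

interpretation fun_space_pair: vector_space_pair scale_fun scale_fun ..

text \<open>
  Since \<open>f\<close> and \<open>g\<close> have the same kernel, \<open>f\<close> factors through \<open>g\<close> by an injective map \<open>\<phi>\<close> on the
  range of \<open>g\<close>. A basis of that range and its image under \<open>\<phi>\<close> are extended to two bases of the
  finite-dimensional space \<open>W\<close>; these have the same size, so \<open>\<phi>\<close> extends to an automorphism \<open>p\<close> of
  \<open>W\<close>, with inverse \<open>q\<close>.
\<close>

lemma extend_to_inverse_pair: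
  assumes f: "Vector_Spaces.linear scale_fun scale_fun f" and g: "Vector_Spaces.linear scale_fun scale_fun g"
    and ker: "\<And>x. f x = 0 \<longleftrightarrow> g x = 0"
    and W: "fun_space.subspace W" "W \<subseteq> fun_space.span E" "finite E"
    and ran: "range f \<subseteq> W" "range g \<subseteq> W"
  obtains p q where
    "Vector_Spaces.linear scale_fun scale_fun p" "Vector_Spaces.linear scale_fun scale_fun q"
    "p ` W \<subseteq> W" "q ` W \<subseteq> W" "\<And>x. p (g x) = f x"
    "\<And>w. w \<in> W \<Longrightarrow> q (p w) = w" "\<And>w. w \<in> W \<Longrightarrow> p (q w) = w"
proof -
  \<comment> \<open>a linear section of \<open>g\<close>; composed with \<open>f\<close> it gives the factor \<open>\<phi>\<close>\<close>
  obtain s where s: "Vector_Spaces.linear scale_fun scale_fun s" "\<And>y. y \<in> range g \<Longrightarrow> g (s y) = y"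
    using fun_space_pair.linear_exists_right_inverse_on[OF g fun_space.subspace_UNIV] by blast
  define \<phi> where "\<phi> = f \<circ> s"
  have \<phi>: "Vector_Spaces.linear scale_fun scale_fun \<phi>"
    unfolding \<phi>_def using s(1) f by (rule Vector_Spaces.linear_compose)
  have \<phi>g: "\<phi> (g x) = f x" for x
  proof -
    have "g (s (g x) - x) = 0"
      using s(2)[of "g x"] by (simp add: fun_space_pair.linear_diff[OF g])
    then have "f (s (g x) - x) = 0" by (simp add: ker)
    then show ?thesis by (simp add: \<phi>_def fun_space_pair.linear_diff[OF f])
  qed
  obtain B where B: "B \<subseteq> range g" "fun_space.independent B" "range g \<subseteq> fun_space.span B"
    using fun_space.maximal_independent_subset[of "range g"] by blast
  have "fun_space.subspace (range g)"
    using fun_space_pair.linear_subspace_image[OF g fun_space.subspace_UNIV] .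
  then have span_B: "fun_space.span B = range g"
    using B(1,3) fun_space.span_minimal by blast
  have "inj_on \<phi> (fun_space.span B)"
  proof (rule inj_onI)
    fix y z assume "y \<in> fun_space.span B" "z \<in> fun_space.span B" and eq: "\<phi> y = \<phi> z"
    then obtain y' z' where y'z': "y = g y'" "z = g z'" unfolding span_B by auto
    then have "f (y' - z') = 0" using eq by (simp add: \<phi>g fun_space_pair.linear_diff[OF f])
    then have "g (y' - z') = 0" by (simp add: ker)
    then show "y = z" using y'z' by (simp add: fun_space_pair.linear_diff[OF g])
  qed
  then have B': "fun_space.independent (\<phi> ` B)" and inj: "inj_on \<phi> B"
    using fun_space_pair.linear_independent_injective_image[OF \<phi> B(2)]
      fun_space.span_superset[of B] by (auto intro: inj_on_subset)
  have "\<phi> ` B \<subseteq> W" "B \<subseteq> W" using B(1) ran by (auto simp: \<phi>g image_subset_iff)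
  obtain D where D: "B \<subseteq> D" "D \<subseteq> W" "fun_space.independent D" "W \<subseteq> fun_space.span D"
    using fun_space.maximal_independent_subset_extend[OF \<open>B \<subseteq> W\<close> B(2)] by blast
  obtain D' where D': "\<phi> ` B \<subseteq> D'" "D' \<subseteq> W" "fun_space.independent D'" "W \<subseteq> fun_space.span D'"
    using fun_space.maximal_independent_subset_extend[OF \<open>\<phi> ` B \<subseteq> W\<close> B'] by blast
  have "finite D" "finite D'"
    using fun_space.independent_span_bound[OF W(3)] D D' W(2) by (meson order.trans)+
  have "card D = card D'"
    using fun_space.basis_card_eq_dim D D' by metis
  then have "card (D - B) = card (D' - \<phi> ` B)"
    using \<open>finite D\<close> \<open>finite D'\<close> D(1) D'(1) inj
    by (simp add: card_Diff_subset finite_subset card_image)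
  then obtain h where "bij_betw h (D - B) (D' - \<phi> ` B)"
    using \<open>finite D\<close> \<open>finite D'\<close> finite_same_card_bij by (metis finite_Diff)
  moreover define h' where "h' x = (if x \<in> B then \<phi> x else h x)" for x
  ultimately have "bij_betw h' (D - B) (D' - \<phi> ` B)"
    using bij_betw_cong[of "D - B" h h'] by simp
  moreover have "bij_betw h' B (\<phi> ` B)"
    using inj by (auto simp: h'_def bij_betw_def inj_on_def)
  ultimately have "bij_betw h' (B \<union> (D - B)) (\<phi> ` B \<union> (D' - \<phi> ` B))"
    by (intro bij_betw_combine) auto
  then have h': "bij_betw h' D D'"
    using D(1) D'(1) by (simp add: Un_absorb1)
  obtain p where p: "Vector_Spaces.linear scale_fun scale_fun p" "\<And>x. x \<in> D \<Longrightarrow> p x = h' x"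
    using fun_space_pair.linear_independent_extend[OF D(3), of h'] by blast
  obtain q where q: "Vector_Spaces.linear scale_fun scale_fun q" "\<And>x. x \<in> D' \<Longrightarrow> q x = inv_into D h' x"
    using fun_space_pair.linear_independent_extend[OF D'(3), of "inv_into D h'"] by blast
  have span: "fun_space.span D = W" "fun_space.span D' = W"
    using D D' W(1) fun_space.span_minimal by blast+
  have pD: "p ` D \<subseteq> D'" using p(2) bij_betwE[OF h'] by auto
  have qD: "q ` D' \<subseteq> D" using q(2) bij_betwE[OF bij_betw_inv_into[OF h']] by auto
  show thesis
  proof
    show "Vector_Spaces.linear scale_fun scale_fun p" "Vector_Spaces.linear scale_fun scale_fun q" by fact+
    show "p ` W \<subseteq> W"
      using fun_space_pair.linear_span_image[OF p(1), of D] fun_space.span_mono[OF pD] span by simp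
    show "q ` W \<subseteq> W"
      using fun_space_pair.linear_span_image[OF q(1), of D'] fun_space.span_mono[OF qD] span by simp
    show "p (g x) = f x" for x
    proof -
      have "p y = \<phi> y" if "y \<in> B" for y using p(2)[of y] that D(1) by (auto simp: h'_def)
      then have "p (g x) = \<phi> (g x)"
        using fun_space_pair.linear_eq_on_span[OF p(1) \<phi>] span_B by blast
      then show ?thesis by (simp add: \<phi>g)
    qed
    show "q (p w) = w" if "w \<in> W" for w
    proof -
      have "(q \<circ> p) y = id y" if "y \<in> D" for y
        using that p(2)[OF that] q(2)[of "h' y"] h' bij_betw_inv_into_left[OF h' that]
        by (auto dest: bij_betwE)
      then show ?thesis
        using fun_space_pair.linear_eq_on_span[OF Vector_Spaces.linear_compose[OF p(1) q(1)] fun_space.linear_id]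
          that span by auto
    qed
    show "p (q w) = w" if "w \<in> W" for w
    proof -
      have "(p \<circ> q) y = id y" if "y \<in> D'" for y
        using that q(2)[OF that] p(2)[of "inv_into D h' y"] bij_betw_inv_into_right[OF h' that]
          bij_betwE[OF bij_betw_inv_into[OF h']]
        by auto
      then show ?thesis
        using fun_space_pair.linear_eq_on_span[OF Vector_Spaces.linear_compose[OF q(1) p(1)] fun_space.linear_id]
          that span by auto
    qed
  qed
qed

text \<open>
  Vectors are sequences here, so that vectors of every length live in one vector space: the matrix is
  applied to the initial segment of its width, and the result is extended by zeros.
\<close>

definition act :: "'a::field mat \<Rightarrow> (nat \<Rightarrow> 'a) \<Rightarrow> nat \<Rightarrow> 'a" where
  "act M v = (\<lambda>i. if i < dim_row M then \<Sum>j<dim_col M. M $$ (i,j) * v j else 0)"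

lemma linear_act: "Vector_Spaces.linear scale_fun scale_fun (act M)"
  by unfold_locales
     (auto simp: act_def scale_fun_def fun_eq_iff distrib_left distrib_right sum.distrib sum_distrib_left mult_ac)

lemma act_mult:
  assumes "P \<in> carrier_mat l m" "M \<in> carrier_mat m k"
  shows "act (P * M) v = act P (act M v)"
proof
  fix i
  show "act (P * M) v i = act P (act M v) i"
  proof (cases "i < l")
    case True
    have "act (P * M) v i = (\<Sum>j<k. \<Sum>h<m. P $$ (i,h) * (M $$ (h,j) * v j))"
      using assms True by (simp add: act_def index_mult_mat_sum[OF assms] sum_distrib_right mult.assoc del: index_mult_mat(1))
    also have "\<dots> = act P (act M v) i"
      using assms True by (subst sum.swap) (simp add: act_def sum_distrib_left)
    finally show ?thesis .
  qed (use assms in \<open>simp add: act_def\<close>)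
qed

lemma finite_support_eq_sum:
  fixes v :: "nat \<Rightarrow> 'a::field"
  assumes "\<And>i. i \<ge> m \<Longrightarrow> v i = 0"
  shows "v = (\<Sum>j<m. scale_fun (v j) (\<lambda>l. if l = j then 1 else 0))"
proof
  fix l
  have "(\<Sum>j<m. scale_fun (v j) (\<lambda>l. if l = j then 1 else 0)) l = (\<Sum>j<m. if l = j then v j else 0)"
    by (simp add: sum_fun_apply scale_fun_def if_distrib[of "\<lambda>z. _ * z"] cong: if_cong)
  also have "\<dots> = v l" using assms[of l] by auto
  finally show "v l = (\<Sum>j<m. scale_fun (v j) (\<lambda>l. if l = j then 1 else 0)) l" ..
qed

lemma linear_on_finite_support:
  fixes v :: "nat \<Rightarrow> 'a::field"
  assumes p: "Vector_Spaces.linear scale_fun scale_fun p" and v: "\<And>i. i \<ge> m \<Longrightarrow> v i = 0"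
  shows "p v i = (\<Sum>j<m. p (\<lambda>l. if l = j then 1 else 0) i * v j)"
proof -
  let ?e = "\<lambda>j l. if l = j then 1 else 0 :: 'a"
  have v_eq: "v = (\<Sum>j<m. scale_fun (v j) (?e j))"
    by (rule finite_support_eq_sum) (rule v)
  have "p (\<Sum>j<m. scale_fun (v j) (?e j)) = (\<Sum>j<m. scale_fun (v j) (p (?e j)))"
    by (simp add: fun_space_pair.linear_sum[OF p] fun_space_pair.linear_scale[OF p])
  then have "p v = (\<Sum>j<m. scale_fun (v j) (p (?e j)))"
    unfolding v_eq[symmetric] .
  then show ?thesis
    by (simp add: sum_fun_apply scale_fun_def mult.commute)
qed

text \<open>
  Both \<open>act M\<close> and \<open>act N\<close> map into the sequences supported on the first \<open>m\<close> positions; \<open>P\<close> is the matrix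
  of an automorphism of that space carrying \<open>act N\<close> to \<open>act M\<close>.
\<close>

theorem left_equivalent_iff_same_kernel:
  fixes M N :: "'a::field mat"
  assumes M: "M \<in> carrier_mat m k" and N: "N \<in> carrier_mat m k"
  shows "(\<exists>P \<in> carrier_mat m m. invertible_mat P \<and> M = P * N) \<longleftrightarrow> (\<forall>v. act M v = 0 \<longleftrightarrow> act N v = 0)"
proof
  assume "\<exists>P \<in> carrier_mat m m. invertible_mat P \<and> M = P * N"
  then obtain P Q where P: "P \<in> carrier_mat m m" and MP: "M = P * N" and Q: "inverts_mat Q P" "inverts_mat P Q"
    by (auto simp: invertible_mat_def)
  have QP: "Q * P = 1\<^sub>m (dim_row Q)" "P * Q = 1\<^sub>m m" using Q P by (auto simp: inverts_mat_def)
  have "dim_col P = dim_row Q" "dim_col Q = m"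
    using QP by (metis index_mult_mat(3) index_one_mat(3))+
  then have Qc: "Q \<in> carrier_mat m m" using P by auto
  have NM: "N = Q * M" using QP(1) Qc P N unfolding MP by (simp flip: assoc_mult_mat)
  have zero: "act K 0 = 0" for K :: "'a mat" by (rule fun_space_pair.linear_0[OF linear_act])
  have "act M v = act P (act N v)" for v
    by (subst MP) (rule act_mult[OF P N])
  moreover have "act N v = act Q (act M v)" for v
    by (subst NM) (rule act_mult[OF Qc M])
  ultimately show "\<forall>v. act M v = 0 \<longleftrightarrow> act N v = 0" using zero by metis
next
  assume ker: "\<forall>v. act M v = 0 \<longleftrightarrow> act N v = 0"
  let ?W = "{v :: nat \<Rightarrow> 'a. \<forall>i\<ge>m. v i = 0}"
  let ?e = "\<lambda>j l. if l = j then 1 else 0 :: 'a"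
  have W: "fun_space.subspace ?W"
    by (rule fun_space.subspaceI) (auto simp: scale_fun_def)
  have W_span: "?W \<subseteq> fun_space.span (?e ` {..<m})"
  proof
    fix v assume "v \<in> ?W"
    then have "v = (\<Sum>j<m. scale_fun (v j) (?e j))"
      by (intro finite_support_eq_sum) simp
    also have "\<dots> \<in> fun_space.span (?e ` {..<m})"
      by (intro fun_space.span_sum fun_space.span_scale fun_space.span_base imageI)
    finally show "v \<in> fun_space.span (?e ` {..<m})" .
  qed
  have ran: "range (act M) \<subseteq> ?W" "range (act N) \<subseteq> ?W"
    using M N by (auto simp: act_def)
  have fin: "finite (?e ` {..<m})" by simp
  obtain p q where p: "Vector_Spaces.linear scale_fun scale_fun p" and q: "Vector_Spaces.linear scale_fun scale_fun q"
    and pW: "p ` ?W \<subseteq> ?W" and qW: "q ` ?W \<subseteq> ?W" and pN: "\<And>x. p (act N x) = act M x"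
    and qp: "\<And>w. w \<in> ?W \<Longrightarrow> q (p w) = w" and pq: "\<And>w. w \<in> ?W \<Longrightarrow> p (q w) = w"
    by (rule extend_to_inverse_pair[OF linear_act linear_act ker[rule_format] W W_span fin ran]) (rule that)
  define P where "P = mat m m (\<lambda>(i,j). p (?e j) i)"
  define Q where "Q = mat m m (\<lambda>(i,j). q (?e j) i)"
  have PQ: "P \<in> carrier_mat m m" "Q \<in> carrier_mat m m" by (simp_all add: P_def Q_def)
  have e: "?e j \<in> ?W" if "j < m" for j using that by auto
  have prod: "(\<Sum>l<m. p (?e l) i * v l) = p v i" "(\<Sum>l<m. q (?e l) i * v l) = q v i" if "v \<in> ?W" for v i
    using linear_on_finite_support[OF p, of m v i] linear_on_finite_support[OF q, of m v i] that by auto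
  have "P * Q = 1\<^sub>m m"
  proof (rule eq_matI)
    fix i j assume "i < dim_row (1\<^sub>m m)" "j < dim_col (1\<^sub>m m)"
    then have ij: "i < m" "j < m" by auto
    have "(P * Q) $$ (i,j) = (\<Sum>l<m. p (?e l) i * q (?e j) l)"
      unfolding index_mult_mat_sum[OF PQ ij] using ij by (simp add: P_def Q_def)
    also have "\<dots> = ?e j i"
      using prod(1)[of "q (?e j)" i] qW e[OF ij(2)] pq[OF e[OF ij(2)]] by (auto simp: image_subset_iff)
    finally show "(P * Q) $$ (i,j) = 1\<^sub>m m $$ (i,j)" using ij by simp
  qed (use PQ in auto)
  moreover have "Q * P = 1\<^sub>m m"
  proof (rule eq_matI)
    fix i j assume "i < dim_row (1\<^sub>m m)" "j < dim_col (1\<^sub>m m)"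
    then have ij: "i < m" "j < m" by auto
    have "(Q * P) $$ (i,j) = (\<Sum>l<m. q (?e l) i * p (?e j) l)"
      unfolding index_mult_mat_sum[OF PQ(2,1) ij] using ij by (simp add: P_def Q_def)
    also have "\<dots> = ?e j i"
      using prod(2)[of "p (?e j)" i] pW e[OF ij(2)] qp[OF e[OF ij(2)]] by (auto simp: image_subset_iff)
    finally show "(Q * P) $$ (i,j) = 1\<^sub>m m $$ (i,j)" using ij by simp
  qed (use PQ in auto)
  ultimately have "invertible_mat P"
    using PQ by (auto simp: invertible_mat_def inverts_mat_def)
  moreover have "M = P * N"
  proof (rule eq_matI)
    fix i j assume "i < dim_row (P * N)" "j < dim_col (P * N)"
    then have ij: "i < m" "j < k" using PQ N by auto
    have col: "act K (?e j) l = K $$ (l,j)" if "K \<in> carrier_mat m k" "l < m" for K l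
      using that ij by (simp add: act_def if_distrib[of "\<lambda>z. _ * z"] cong: if_cong)
    have "(P * N) $$ (i,j) = (\<Sum>l<m. p (?e l) i * act N (?e j) l)"
      unfolding index_mult_mat_sum[OF PQ(1) N ij] using ij N by (simp add: P_def col)
    also have "\<dots> = act M (?e j) i"
      using prod(1)[of "act N (?e j)" i] N pN by (simp add: act_def)
    finally show "M $$ (i,j) = (P * N) $$ (i,j)" using col[OF M ij(1)] by simp
  qed (use PQ M N in auto)
  ultimately show "\<exists>P \<in> carrier_mat m m. invertible_mat P \<and> M = P * N" using PQ by blast
qed

section \<open>Kronecker products\<close>

lemma sum_div_mod:
  fixes f :: "nat \<Rightarrow> 'a::comm_monoid_add"
  shows "(\<Sum>c<n * n. f c) = (\<Sum>s<n. \<Sum>t<n. f (s * n + t))"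
proof -
  have "sum f {s * n..<s * n + n} = (\<Sum>t<n. f (s * n + t))" for s
    by (rule sum.reindex_bij_witness[of _ "\<lambda>t. s * n + t" "\<lambda>c. c - s * n"]) auto
  then show ?thesis by (simp flip: sum.nat_group)
qed

lemma flat_index_less:
  assumes "s < n" "t < (n::nat)"
  shows "s * n + t < n * n"
proof -
  have "s * n + t < Suc s * n" using assms by simp
  also have "\<dots> \<le> n * n" using assms by (intro mult_le_mono1) simp
  finally show ?thesis .
qed

definition ad_mat :: "nat \<Rightarrow> 'a::comm_ring_1 mat \<Rightarrow> 'a mat" where
  "ad_mat n A = 1\<^sub>m n \<otimes>\<^sub>k A - A\<^sup>T \<otimes>\<^sub>k 1\<^sub>m n"

lemma ad_mat_carrier: "A \<in> carrier_mat n n \<Longrightarrow> ad_mat n A \<in> carrier_mat (n * n) (n * n)"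
  by (auto simp: ad_mat_def kronecker_product_def)

text \<open>
  With the columns of \<open>Y\<close> stacked, \<open>I \<otimes> A\<close> is multiplication by \<open>A\<close> from the left and
  \<open>A\<^sup>T \<otimes> I\<close> multiplication by \<open>A\<close> from the right.
\<close>

lemma act_ad_mat:
  fixes A :: "'a::field mat" and v :: "nat \<Rightarrow> 'a"
  assumes A: "A \<in> carrier_mat n n" and pq: "p < n" "q < n"
  defines "Y \<equiv> mat n n (\<lambda>(t,s). v (s * n + t))"
  shows "act (ad_mat n A) v (q * n + p) = (A * Y - Y * A) $$ (p,q)"
proof -
  have Y: "Y \<in> carrier_mat n n" by (simp add: Y_def)
  have entry: "ad_mat n A $$ (q * n + p, s * n + t) = (if q = s then A $$ (p,t) else 0) - (if p = t then A $$ (s,q) else 0)"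
    if "s < n" "t < n" for s t
    using that A pq flat_index_less[of q n p] flat_index_less[of s n t]
    by (simp add: ad_mat_def kronecker_product_def)
  have "act (ad_mat n A) v (q * n + p) = (\<Sum>s<n. \<Sum>t<n. ad_mat n A $$ (q * n + p, s * n + t) * v (s * n + t))"
    using ad_mat_carrier[OF A] flat_index_less[OF pq(2,1)] by (simp add: act_def sum_div_mod)
  also have "\<dots> = (\<Sum>s<n. \<Sum>t<n. (if q = s then A $$ (p,t) * v (s * n + t) else 0))
       - (\<Sum>s<n. \<Sum>t<n. (if p = t then A $$ (s,q) * v (s * n + t) else 0))"
    unfolding sum_subtractf[symmetric] by (intro sum.cong refl) (simp add: entry left_diff_distrib)
  also have "(\<Sum>s<n. \<Sum>t<n. (if q = s then A $$ (p,t) * v (s * n + t) else 0)) = (A * Y) $$ (p,q)"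
    unfolding index_mult_mat_sum[OF A Y pq] using pq
    by (subst sum.swap) (simp add: Y_def)
  also have "(\<Sum>s<n. \<Sum>t<n. (if p = t then A $$ (s,q) * v (s * n + t) else 0)) = (Y * A) $$ (p,q)"
    unfolding index_mult_mat_sum[OF Y A pq] using pq by (simp add: Y_def mult.commute)
  finally show ?thesis using A Y pq by simp
qed

lemma act_ad_mat_eq_0_iff:
  fixes A :: "'a::field mat" and v :: "nat \<Rightarrow> 'a"
  assumes A: "A \<in> carrier_mat n n"
  defines "Y \<equiv> mat n n (\<lambda>(t,s). v (s * n + t))"
  shows "act (ad_mat n A) v = 0 \<longleftrightarrow> A * Y = Y * A"
proof
  assume v: "act (ad_mat n A) v = 0"
  show "A * Y = Y * A"
  proof (rule eq_matI)
    fix p q assume "p < dim_row (Y * A)" "q < dim_col (Y * A)"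
    then have pq: "p < n" "q < n" using A by (auto simp: Y_def)
    then have "(A * Y - Y * A) $$ (p,q) = 0"
      using act_ad_mat[OF A pq, of v] v by (simp add: Y_def)
    then show "(A * Y) $$ (p,q) = (Y * A) $$ (p,q)"
      using A pq by (simp add: Y_def del: index_mult_mat(1))
  qed (use A in \<open>auto simp: Y_def\<close>)
next
  assume eq: "A * Y = Y * A"
  show "act (ad_mat n A) v = 0"
  proof
    fix c
    show "act (ad_mat n A) v c = 0 c"
    proof (cases "c < n * n")
      case True
      then have n: "n > 0" by (cases n) auto
      then have dm: "c mod n < n" "c div n < n"
        using True by (auto simp: less_mult_imp_div_less)
      then have "(A * Y - Y * A) $$ (c mod n, c div n) = 0"
        using A unfolding eq by (simp add: Y_def del: index_mult_mat(1))
      then show ?thesis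
        using act_ad_mat[OF A dm, of v] by (simp add: Y_def)
    next
      case False
      then show ?thesis using ad_mat_carrier[OF A] by (simp add: act_def)
    qed
  qed
qed

lemma centralizer_eq_iff_left_equivalent:
  fixes A B :: "'a::field mat"
  assumes A: "A \<in> carrier_mat n n" and B: "B \<in> carrier_mat n n"
  shows "mat_centralizer n A = mat_centralizer n B \<longleftrightarrow>
    (\<exists>P \<in> carrier_mat (n\<^sup>2) (n\<^sup>2). invertible_mat P \<and>
          1\<^sub>m n \<otimes>\<^sub>k A - A\<^sup>T \<otimes>\<^sub>k 1\<^sub>m n
            = P * (1\<^sub>m n \<otimes>\<^sub>k B - B\<^sup>T \<otimes>\<^sub>k 1\<^sub>m n))"
proof -
  let ?Y = "\<lambda>v. mat n n (\<lambda>(t,s). v (s * n + t))"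
  have surj: "\<exists>v. Y = ?Y v" if "Y \<in> carrier_mat n n" for Y :: "'a mat"
    using that by (intro exI[of _ "\<lambda>c. Y $$ (c mod n, c div n)"]) auto
  have "mat_centralizer n A = mat_centralizer n B \<longleftrightarrow> (\<forall>Y \<in> carrier_mat n n. A * Y = Y * A \<longleftrightarrow> B * Y = Y * B)"
    by (auto simp: mat_centralizer_def)
  also have "\<dots> \<longleftrightarrow> (\<forall>v. A * ?Y v = ?Y v * A \<longleftrightarrow> B * ?Y v = ?Y v * B)"
  proof
    assume L: "\<forall>v. A * ?Y v = ?Y v * A \<longleftrightarrow> B * ?Y v = ?Y v * B"
    show "\<forall>Y \<in> carrier_mat n n. A * Y = Y * A \<longleftrightarrow> B * Y = Y * B"
    proof
      fix Y :: "'a mat" assume "Y \<in> carrier_mat n n"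
      then obtain v where "Y = ?Y v" using surj by blast
      then show "A * Y = Y * A \<longleftrightarrow> B * Y = Y * B" using spec[OF L, of v] by (simp only:)
    qed
  qed simp
  also have "\<dots> \<longleftrightarrow> (\<forall>v. act (ad_mat n A) v = 0 \<longleftrightarrow> act (ad_mat n B) v = 0)"
    by (simp add: act_ad_mat_eq_0_iff[OF A] act_ad_mat_eq_0_iff[OF B])
  finally show ?thesis
    using left_equivalent_iff_same_kernel[OF ad_mat_carrier[OF A] ad_mat_carrier[OF B]]
    by (simp add: ad_mat_def power2_eq_square)
qed

section \<open>Powers of the commutator map\<close>

lemma mat_ad_carrier [simp]:
  "H \<in> carrier_mat n n \<Longrightarrow> Y \<in> carrier_mat n n \<Longrightarrow> mat_ad H Y \<in> carrier_mat n n"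
  unfolding mat_ad_def by (intro minus_carrier_mat mult_carrier_mat)

lemma mat_ad_pow_carrier [simp]:
  "H \<in> carrier_mat n n \<Longrightarrow> Y \<in> carrier_mat n n \<Longrightarrow> (mat_ad H ^^ k) Y \<in> carrier_mat n n"
  by (induction k) simp_all

lemma mat_ad_eq_0_iff:
  assumes "H \<in> carrier_mat n n" "Y \<in> carrier_mat n n"
  shows "mat_ad H Y = 0\<^sub>m n n \<longleftrightarrow> H * Y = Y * H"
proof
  assume 0: "mat_ad H Y = 0\<^sub>m n n"
  show "H * Y = Y * H"
  proof (rule eq_matI)
    fix i j assume ij: "i < dim_row (Y * H)" "j < dim_col (Y * H)"
    then have "(mat_ad H Y) $$ (i,j) = 0" unfolding 0 using assms by simp
    then show "(H * Y) $$ (i,j) = (Y * H) $$ (i,j)"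
      using ij by (simp add: mat_ad_def del: index_mult_mat(1))
  qed (use assms in auto)
qed (use assms in \<open>simp add: mat_ad_def\<close>)

lemma mat_ad_zero [simp]:
  "H \<in> carrier_mat n n \<Longrightarrow> mat_ad H (0\<^sub>m n n) = 0\<^sub>m n n"
  by (simp add: mat_ad_def)

lemma mat_ad_pow_zero [simp]:
  "H \<in> carrier_mat n n \<Longrightarrow> (mat_ad H ^^ k) (0\<^sub>m n n) = 0\<^sub>m n n"
  by (induction k) simp_all

lemma mat_ad_pow_eq_0_mono:
  assumes "H \<in> carrier_mat n n" "(mat_ad H ^^ k) Y = 0\<^sub>m n n" "k \<le> l"
  shows "(mat_ad H ^^ l) Y = 0\<^sub>m n n"
  using assms funpow_add[of "l - k" k "mat_ad H"] by simp

lemma mat_cancel_left: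
  fixes P Q :: "'a::comm_ring_1 mat"
  assumes "Q \<in> carrier_mat n n" "P \<in> carrier_mat n n" "Q * P = 1\<^sub>m n" "Z \<in> carrier_mat n n"
  shows "Q * (P * Z) = Z"
  using assoc_mult_mat[OF assms(1,2,4), symmetric] left_mult_one_mat[OF assms(4)]
  unfolding assms(3) by simp

lemma mat_ad_conjugate:
  assumes PQ: "P \<in> carrier_mat n n" "Q \<in> carrier_mat n n" "Q * P = 1\<^sub>m n"
    and D: "D \<in> carrier_mat n n" and Y: "Y \<in> carrier_mat n n"
  shows "mat_ad (P * D * Q) (P * Y * Q) = P * mat_ad D Y * Q"
proof -
  have *: "P * U * Q * (P * V * Q) = P * (U * V) * Q" if "U \<in> carrier_mat n n" "V \<in> carrier_mat n n" for U V
  proof -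
    have "Q * (P * (V * Q)) = V * Q"
      by (rule mat_cancel_left[OF PQ(2,1,3) mult_carrier_mat[OF that(2) PQ(2)]])
    then show ?thesis
      using PQ that by (simp add: assoc_mult_mat[of _ n n _ n _ n] mult_carrier_mat[of _ n n _ n])
  qed
  have DY: "D * Y \<in> carrier_mat n n" and YD: "Y * D \<in> carrier_mat n n"
    using D Y by auto
  have "P * mat_ad D Y * Q = P * (D * Y) * Q - P * (Y * D) * Q"
    unfolding mat_ad_def mult_minus_distrib_mat[OF PQ(1) DY YD]
    by (rule minus_mult_distrib_mat[OF mult_carrier_mat[OF PQ(1) DY] mult_carrier_mat[OF PQ(1) YD] PQ(2)])
  then show ?thesis
    unfolding mat_ad_def using *[OF D Y] *[OF Y D] by simp
qed

lemma mat_ad_pow_conjugate: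
  assumes PQ: "P \<in> carrier_mat n n" "Q \<in> carrier_mat n n" "Q * P = 1\<^sub>m n"
    and D: "D \<in> carrier_mat n n" and Y: "Y \<in> carrier_mat n n"
  shows "(mat_ad (P * D * Q) ^^ k) (P * Y * Q) = P * (mat_ad D ^^ k) Y * Q"
  by (induction k) (simp_all add: mat_ad_conjugate[OF PQ D] D Y)

lemma conjugate_eq_0:
  fixes P Q :: "'a::comm_ring_1 mat"
  assumes PQ: "P \<in> carrier_mat n n" "Q \<in> carrier_mat n n" "Q * P = 1\<^sub>m n"
    and Y: "Y \<in> carrier_mat n n" and 0: "P * Y * Q = 0\<^sub>m n n"
  shows "Y = 0\<^sub>m n n"
proof -
  have "Q * (P * Y * Q) * P = Y"
    using PQ Y by (simp add: assoc_mult_mat[of _ n n _ n _ n] mult_carrier_mat[of _ n n _ n] mat_cancel_left[of _ n])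
  then show ?thesis using PQ Y by (simp add: 0)
qed

lemma conjugate_conjugate:
  fixes P Q :: "'a::comm_ring_1 mat"
  assumes "P \<in> carrier_mat n n" "Q \<in> carrier_mat n n" "P * Q = 1\<^sub>m n" "Y \<in> carrier_mat n n"
  shows "P * (Q * Y * P) * Q = Y"
  using assms by (simp add: assoc_mult_mat[of _ n n _ n _ n] mult_carrier_mat[of _ n n _ n] mat_cancel_left[of _ n])

lemma index_mat_ad_diagonal_pow:
  assumes D: "D \<in> carrier_mat n n" and Y: "Y \<in> carrier_mat n n"
    and diag: "\<And>i j. i < n \<Longrightarrow> j < n \<Longrightarrow> i \<noteq> j \<Longrightarrow> D $$ (i,j) = 0"
    and ij: "i < n" "j < n"
  shows "(mat_ad D ^^ k) Y $$ (i,j) = (D $$ (i,i) - D $$ (j,j)) ^ k * Y $$ (i,j)"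
proof -
  have 1: "mat_ad D Z $$ (i,j) = (D $$ (i,i) - D $$ (j,j)) * Z $$ (i,j)" if Z: "Z \<in> carrier_mat n n" for Z
  proof -
    have "(D * Z) $$ (i,j) = (\<Sum>l<n. if l = i then D $$ (i,i) * Z $$ (i,j) else 0)"
      unfolding index_mult_mat_sum[OF D Z ij] using diag ij by (intro sum.cong refl) auto
    moreover have "(Z * D) $$ (i,j) = (\<Sum>l<n. if l = j then Z $$ (i,j) * D $$ (j,j) else 0)"
      unfolding index_mult_mat_sum[OF Z D ij] using diag ij by (intro sum.cong refl) auto
    ultimately show ?thesis
      using D Z ij by (simp add: mat_ad_def algebra_simps del: index_mult_mat(1))
  qed
  show ?thesis
  proof (induction k)
    case (Suc k)
    then show ?case using 1[of "(mat_ad D ^^ k) Y"] D Y by simp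
  qed simp
qed

text \<open>
  In a basis of eigenvectors \<open>ad\<^sub>D\<close> multiplies the entry \<open>(i,j)\<close> by the difference of two
  eigenvalues, so a power of it vanishes only where it vanishes itself.
\<close>

lemma diagonalizable_mat_ad_pow_eq_0:
  fixes D :: "'a::idom mat"
  assumes PQ: "P \<in> carrier_mat n n" "Q \<in> carrier_mat n n" "P * Q = 1\<^sub>m n" "Q * P = 1\<^sub>m n"
    and D: "D \<in> carrier_mat n n" and Y: "Y \<in> carrier_mat n n"
    and diag: "\<And>i j. i < n \<Longrightarrow> j < n \<Longrightarrow> i \<noteq> j \<Longrightarrow> D $$ (i,j) = 0"
    and 0: "(mat_ad (P * D * Q) ^^ k) Y = 0\<^sub>m n n"
  shows "mat_ad (P * D * Q) Y = 0\<^sub>m n n"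
proof -
  define Z where "Z = Q * Y * P"
  have Z: "Z \<in> carrier_mat n n" using PQ Y by (simp add: Z_def)
  have YZ: "Y = P * Z * Q"
    unfolding Z_def using conjugate_conjugate[OF PQ(1-3) Y] by simp
  have "P * (mat_ad D ^^ k) Z * Q = 0\<^sub>m n n"
    using 0 unfolding YZ mat_ad_pow_conjugate[OF PQ(1,2,4) D Z] .
  then have "(mat_ad D ^^ k) Z = 0\<^sub>m n n"
    by (rule conjugate_eq_0[OF PQ(1,2,4) mat_ad_pow_carrier[OF D Z]])
  then have "(D $$ (i,i) - D $$ (j,j)) ^ k * Z $$ (i,j) = 0" if "i < n" "j < n" for i j
    using index_mat_ad_diagonal_pow[OF D Z diag that, of k] that by simp
  then have "(D $$ (i,i) - D $$ (j,j)) * Z $$ (i,j) = 0" if "i < n" "j < n" for i j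
    using that by fastforce
  then have "mat_ad D Z $$ (i,j) = 0" if "i < n" "j < n" for i j
    using index_mat_ad_diagonal_pow[OF D Z diag that, of 1] that by simp
  then have "mat_ad D Z = 0\<^sub>m n n"
    by (intro eq_matI) (simp_all add: carrier_matD[OF mat_ad_carrier[OF D Z]])
  then show ?thesis
    unfolding YZ using mat_ad_conjugate[OF PQ(1,2,4) D Z] PQ by simp
qed

lemma jordan_matrix_Cons:
  "jordan_matrix ((m,a) # n_as) =
    four_block_mat (jordan_block m a) (0\<^sub>m m (sum_list (map fst n_as)))
      (0\<^sub>m (sum_list (map fst n_as)) m) (jordan_matrix n_as)"
  using jordan_matrix_dim[of n_as] by (simp add: jordan_matrix_def Let_def)

lemma jordan_matrix_off_diagonal:
  assumes "i < sum_list (map fst n_as)" "j < sum_list (map fst n_as)" "i \<noteq> j"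
    "jordan_matrix n_as $$ (i,j) \<noteq> 0"
  shows "j = Suc i \<and> jordan_matrix n_as $$ (i,i) = jordan_matrix n_as $$ (j,j)"
  using assms
proof (induction n_as arbitrary: i j)
  case (Cons na n_as)
  obtain m a where na: "na = (m,a)" by fastforce
  let ?N = "sum_list (map fst n_as)"
  have entry: "jordan_matrix (na # n_as) $$ (k,l) =
      (if k < m then if l < m then jordan_block m a $$ (k,l) else 0
       else if l < m then 0 else jordan_matrix n_as $$ (k - m, l - m))"
    if "k < m + ?N" "l < m + ?N" for k l
    using that by (auto simp: na jordan_matrix_Cons)
  have ij: "i < m + ?N" "j < m + ?N" using Cons.prems(1,2) by (simp_all add: na)
  show ?case
  proof (cases "i < m")
    case True
    then show ?thesis using Cons.prems(3,4) ij
      by (auto simp: entry jordan_block_def split: if_splits)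
  next
    case False
    then have "\<not> j < m" using Cons.prems(4) ij by (auto simp: entry)
    moreover have "i - m \<noteq> j - m" using False \<open>\<not> j < m\<close> Cons.prems(3) by arith
    ultimately show ?thesis
      using False Cons.IH[of "i - m" "j - m"] Cons.prems(4) ij
      by (simp add: entry) arith
  qed
qed simp

section \<open>Jordan form over an algebraically closed field\<close>

text \<open>
  An eigenvector exists over an algebraically closed field; completing it to a basis splits off
  the first column, and the remaining block is handled by induction.
\<close>

lemma upper_triangularizable:
  fixes A :: "'a::alg_closed_field mat"
  assumes "A \<in> carrier_mat n n"
  shows "\<exists>U \<in> carrier_mat n n. upper_triangular U \<and> similar_mat A U"
  using assms
proof (induction n arbitrary: A)
  case 0
  then have "upper_triangular A" by auto
  then show ?case using 0 similar_mat_refl by blast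
next
  case (Suc n)
  note A = Suc.prems
  have "degree (char_poly A) = Suc n" using degree_monic_char_poly[OF A] by simp
  then obtain e where "poly (char_poly A) e = 0"
    using alg_closed_imp_poly_has_root[of "char_poly A"] by auto
  then have "eigenvalue A e" by (simp add: eigenvalue_root_char_poly[OF A])
  then obtain v where "eigenvector A v e" by (auto simp: eigenvalue_def)
  then have v: "v \<in> carrier_vec (Suc n)" "v \<noteq> 0\<^sub>v (Suc n)" and Av: "A *\<^sub>v v = e \<cdot>\<^sub>v v"
    using A by (auto simp: eigenvector_def)
  interpret vec_space "TYPE('a)" "Suc n" .
  define W where "W = mat_of_cols (Suc n) (basis_completion v)"
  note bc = basis_completion[OF v]
  have W: "W \<in> carrier_mat (Suc n) (Suc n)"
    using bc(6) mat_of_cols_carrier(1)[of "Suc n" "basis_completion v"] by (simp add: W_def)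
  have "cols W = basis_completion v"
    unfolding W_def using bc(2) by (rule cols_mat_of_cols)
  then have "rank W = Suc n"
    using lin_indpt_full_rank[OF W] bc by simp
  then have "det W \<noteq> 0" using det_rank_iff[OF W] by simp
  from det_non_zero_imp_unit[OF W this, unfolded Units_def ring_mat_simps]
  obtain V where V: "V \<in> carrier_mat (Suc n) (Suc n)" "V * W = 1\<^sub>m (Suc n)" "W * V = 1\<^sub>m (Suc n)"
    by auto
  have col_W: "col W 0 = v"
    using bc unfolding W_def by (cases "basis_completion v") (auto simp: col_mat_of_cols)
  define A' where "A' = V * A * W"
  have A': "A' \<in> carrier_mat (Suc n) (Suc n)" using V W A by (simp add: A'_def)
  have sim: "similar_mat A' A"
    unfolding similar_mat_def A'_def
    by (intro exI, rule similar_mat_witI[OF V(2,3) refl]) (use V W A in auto)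
  have "col A' 0 = V *\<^sub>v (A *\<^sub>v v)"
    unfolding A'_def assoc_mult_mat[OF V(1) A W]
    by (simp add: col_mult2[OF V(1) mult_carrier_mat[OF A W]] col_mult2[OF A W] col_W)
  also have "\<dots> = e \<cdot>\<^sub>v (V *\<^sub>v v)"
    using V(1) v by (simp add: Av mult_mat_vec)
  also have "V *\<^sub>v v = col (V * W) 0"
    unfolding col_mult2[OF V(1) W zero_less_Suc] col_W ..
  finally have col_eq: "col A' 0 = e \<cdot>\<^sub>v col (V * W) 0" .
  have col_A': "A' $$ (i, 0) = (if i = 0 then e else 0)" if "i < Suc n" for i
  proof -
    have "A' $$ (i, 0) = vec_index (col A' 0) i" using that A' by simp
    also have "\<dots> = (if i = 0 then e else 0)" unfolding col_eq V(2) using that by simp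
    finally show ?thesis .
  qed
  obtain A1 A2 A0 A3 where split: "split_block A' 1 1 = (A1, A2, A0, A3)"
    by (cases "split_block A' 1 1") auto
  note blocks = split_block[OF split, of n n]
  have A123: "A1 \<in> carrier_mat 1 1" "A2 \<in> carrier_mat 1 n" "A0 \<in> carrier_mat n 1" "A3 \<in> carrier_mat n n"
    and A'_eq: "A' = four_block_mat A1 A2 A0 A3"
    using blocks A' by auto
  have A0: "A0 = 0\<^sub>m n 1"
    using split A' col_A' by (auto simp: split_block_def Let_def intro!: eq_matI)
  obtain U P Q where U: "U \<in> carrier_mat n n" "upper_triangular U" and wit: "similar_mat_wit A3 U P Q"
    using Suc.IH[OF A123(4)] by (auto simp: similar_mat_def)
  note PQ = similar_mat_witD2[OF A123(4) wit]
  let ?U = "four_block_mat A1 (A2 * P) (0\<^sub>m n 1) U"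
  have A2: "A2 = 1\<^sub>m 1 * (A2 * P) * Q"
    using A123(2) PQ by (simp add: assoc_mult_mat[of _ 1 n _ n _ n])
  have zero: "A0 = P * 0\<^sub>m n 1 * 1\<^sub>m 1" using PQ by (simp add: A0)
  have "similar_mat A' ?U"
    unfolding similar_mat_def A'_eq
    by (intro exI, rule similar_mat_wit_four_block[OF similar_mat_wit_refl[OF A123(1)] wit A2 zero A123(1,4)])
      (use A123 PQ in auto)
  then have "similar_mat A ?U"
    using similar_mat_trans similar_mat_sym sim by blast
  moreover have "upper_triangular ?U"
    using A123 U by (intro upper_triangular_four_block) auto
  moreover have "?U \<in> carrier_mat (Suc n) (Suc n)"
    using four_block_carrier_mat[OF A123(1) U(1)] by simp
  ultimately show ?case by blast
qed

lemma jordan_nf_alg_closed: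
  fixes A :: "'a::alg_closed_field mat"
  assumes A: "A \<in> carrier_mat n n"
  obtains n_as P Q where "P \<in> carrier_mat n n" "Q \<in> carrier_mat n n" "P * Q = 1\<^sub>m n" "Q * P = 1\<^sub>m n"
    "jordan_matrix n_as \<in> carrier_mat n n" "A = P * jordan_matrix n_as * Q"
proof -
  obtain U where U: "U \<in> carrier_mat n n" "upper_triangular U" "similar_mat A U"
    using upper_triangularizable[OF A] by blast
  then have "similar_mat A (jordan_matrix (triangular_to_jnf_vector U))"
    using triangular_to_jnf_vector[OF U(1,2)] similar_mat_trans unfolding jordan_nf_def by blast
  then obtain P Q where "similar_mat_wit A (jordan_matrix (triangular_to_jnf_vector U)) P Q"
    by (auto simp: similar_mat_def)
  from similar_mat_witD2[OF A this] show ?thesis using that by blast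
qed

text \<open>
  For \<open>J = D - N\<close> with diagonal part \<open>D\<close>, the matrix \<open>H\<close> grades the superdiagonal: \<open>[J, H] = N\<close>,
  because a nonzero off-diagonal entry of \<open>J\<close> has column index one above its row index. This \<open>N\<close>
  commutes with \<open>D\<close>, hence with \<open>J\<close>, since such an entry only links equal diagonal entries; and
  \<open>N = 0\<close> means that \<open>J\<close> is diagonal. Numbering the positions globally instead of separately in each
  block is harmless, as no entry links two blocks.
\<close>

lemma jordan_matrix_grading:
  fixes n_as :: "(nat \<times> 'a::comm_ring_1) list" and n :: nat
  defines "J \<equiv> jordan_matrix n_as"
    and "H \<equiv> mat n n (\<lambda>(i,j). if i = j then - of_nat i else 0)"
  assumes J: "J \<in> carrier_mat n n"
  shows "mat_ad J (mat_ad J H) = 0\<^sub>m n n"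
    and "mat_ad H J = 0\<^sub>m n n \<Longrightarrow> i < n \<Longrightarrow> j < n \<Longrightarrow> i \<noteq> j \<Longrightarrow> J $$ (i,j) = 0"
proof -
  have H: "H \<in> carrier_mat n n" by (simp add: H_def)
  have sum: "sum_list (map fst n_as) = n" using J unfolding J_def by auto
  have super: "j = Suc i" "J $$ (i,i) = J $$ (j,j)"
    if "i < n" "j < n" "i \<noteq> j" "J $$ (i,j) \<noteq> 0" for i j
    using jordan_matrix_off_diagonal[of i n_as j] that by (simp_all add: sum J_def)
  have HJ: "mat_ad H J $$ (i,j) = (of_nat j - of_nat i) * J $$ (i,j)" if "i < n" "j < n" for i j
    using index_mat_ad_diagonal_pow[OF H J _ that, of 1] that by (simp add: H_def)
  define N where "N = mat_ad J H"
  have N: "N \<in> carrier_mat n n" using J H by (simp add: N_def)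
  have N_entry: "N $$ (i,j) = (if i = j then 0 else - J $$ (i,j))" if "i < n" "j < n" for i j
  proof -
    have "N $$ (i,j) = - mat_ad H J $$ (i,j)"
      using that J H by (simp add: N_def mat_ad_def del: index_mult_mat(1))
    also have "\<dots> = (if i = j then 0 else - J $$ (i,j))"
    proof (cases "i = j \<or> J $$ (i,j) = 0")
      case False
      then have "of_nat j - of_nat i = (1::'a)" using super(1)[OF that] by simp
      then show ?thesis using False by (simp add: HJ[OF that])
    qed (auto simp: HJ[OF that])
    finally show ?thesis .
  qed
  define D where "D = mat n n (\<lambda>(i,j). if i = j then J $$ (i,j) else 0)"
  have D: "D \<in> carrier_mat n n" by (simp add: D_def)
  have "mat_ad D N = 0\<^sub>m n n"
  proof (rule eq_matI)
    fix i j assume "i < dim_row (0\<^sub>m n n)" "j < dim_col (0\<^sub>m n n)"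
    then have ij: "i < n" "j < n" by auto
    have "mat_ad D N $$ (i,j) = (J $$ (i,i) - J $$ (j,j)) * N $$ (i,j)"
      using index_mat_ad_diagonal_pow[OF D N _ ij, of 1] ij by (simp add: D_def)
    also have "\<dots> = 0"
    proof (cases "i = j \<or> J $$ (i,j) = 0")
      case False
      then have "J $$ (i,i) = J $$ (j,j)" using super(2)[OF ij] by blast
      then show ?thesis by simp
    qed (auto simp: N_entry[OF ij])
    finally show "mat_ad D N $$ (i,j) = 0\<^sub>m n n $$ (i,j)" using ij by simp
  qed (simp_all add: carrier_matD[OF mat_ad_carrier[OF D N]])
  then have DN: "D * N = N * D" using mat_ad_eq_0_iff[OF D N] by simp
  have "J = D - N"
  proof (rule eq_matI)
    fix i j assume "i < dim_row (D - N)" "j < dim_col (D - N)"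
    then have ij: "i < n" "j < n" using N by auto
    then show "J $$ (i,j) = (D - N) $$ (i,j)"
      using N by (simp add: D_def N_entry)
  qed (use J N in auto)
  then have "J * N = D * N - N * N" "N * J = N * D - N * N"
    using minus_mult_distrib_mat[OF D N N] mult_minus_distrib_mat[OF N D N] by simp_all
  then have "J * N = N * J" by (simp add: DN)
  then show "mat_ad J (mat_ad J H) = 0\<^sub>m n n"
    unfolding N_def[symmetric] using mat_ad_eq_0_iff[OF J N] by simp
  show "J $$ (i,j) = 0" if "mat_ad H J = 0\<^sub>m n n" "i < n" "j < n" "i \<noteq> j"
  proof (rule ccontr)
    assume "J $$ (i,j) \<noteq> 0"
    with super(1)[OF that(2-4)] HJ[OF that(2,3)] that show False by simp
  qed
qed

section \<open>Kernels and annihilators\<close>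

text \<open>
  The grading element \<open>h\<close> of the Jordan
  form of \<open>A\<close> lies in the kernel of \<open>ad\<^sub>A\<^sup>2\<close>. Being diagonalizable, it commutes with every matrix that some
  power of \<open>ad\<^sub>h\<close> sends to zero: first with \<open>B\<close>, by \<open>kerA\<close>, then with \<open>A\<close>, by \<open>kerB\<close>. The latter forces the
  nilpotent part of \<open>A\<close> to vanish, and for a diagonalizable \<open>A\<close> the kernels of all powers of \<open>ad\<^sub>A\<close>
  agree.
\<close>

lemma semisimple_of_kernels_in_annihilators:
  fixes A B :: "'a::alg_closed_field mat"
  assumes A: "A \<in> carrier_mat n n" and B: "B \<in> carrier_mat n n"
    and kerA: "\<And>Y. Y \<in> carrier_mat n n \<Longrightarrow> (mat_ad A ^^ k) Y = 0\<^sub>m n n \<Longrightarrow> (mat_ad Y ^^ k) B = 0\<^sub>m n n"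
    and kerB: "\<And>Y. Y \<in> carrier_mat n n \<Longrightarrow> (mat_ad B ^^ l) Y = 0\<^sub>m n n \<Longrightarrow> (mat_ad Y ^^ l) A = 0\<^sub>m n n"
    and k: "k \<ge> 2" and l: "l \<ge> 1"
    and Y: "Y \<in> carrier_mat n n" and nil: "(mat_ad A ^^ m) Y = 0\<^sub>m n n"
  shows "mat_ad A Y = 0\<^sub>m n n"
proof -
  obtain n_as P Q where PQ: "P \<in> carrier_mat n n" "Q \<in> carrier_mat n n" "P * Q = 1\<^sub>m n" "Q * P = 1\<^sub>m n"
    and J: "jordan_matrix n_as \<in> carrier_mat n n" and A_eq: "A = P * jordan_matrix n_as * Q"
    by (rule jordan_nf_alg_closed[OF A])
  define H :: "'a mat" where "H = mat n n (\<lambda>(i,j). if i = j then - of_nat i else 0)"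
  have H: "H \<in> carrier_mat n n" by (simp add: H_def)
  note grading = jordan_matrix_grading[OF J, folded H_def]
  define h where "h = P * H * Q"
  have h: "h \<in> carrier_mat n n" using PQ H by (simp add: h_def)
  have h_semisimple: "mat_ad h Z = 0\<^sub>m n n" if "Z \<in> carrier_mat n n" "(mat_ad h ^^ i) Z = 0\<^sub>m n n" for Z i
    using diagonalizable_mat_ad_pow_eq_0[OF PQ H that(1)] that(2) unfolding h_def by (simp add: H_def)
  have "(mat_ad A ^^ 2) h = P * (mat_ad (jordan_matrix n_as) ^^ 2) H * Q"
    unfolding A_eq h_def by (rule mat_ad_pow_conjugate[OF PQ(1,2,4) J H])
  also have "\<dots> = 0\<^sub>m n n" using grading(1) PQ by (simp add: numeral_2_eq_2)
  finally have "(mat_ad A ^^ k) h = 0\<^sub>m n n" using k by (rule mat_ad_pow_eq_0_mono[OF A])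
  from kerA[OF h this] have "mat_ad h B = 0\<^sub>m n n" by (rule h_semisimple[OF B])
  then have "mat_ad B h = 0\<^sub>m n n" by (simp add: mat_ad_eq_0_iff[OF h B] mat_ad_eq_0_iff[OF B h])
  then have "(mat_ad B ^^ 1) h = 0\<^sub>m n n" by simp
  then have "(mat_ad B ^^ l) h = 0\<^sub>m n n" using l by (rule mat_ad_pow_eq_0_mono[OF B])
  from kerB[OF h this] have "mat_ad h A = 0\<^sub>m n n" by (rule h_semisimple[OF A])
  then have "P * mat_ad H (jordan_matrix n_as) * Q = 0\<^sub>m n n"
    unfolding A_eq h_def mat_ad_conjugate[OF PQ(1,2,4) H J] .
  then have "mat_ad H (jordan_matrix n_as) = 0\<^sub>m n n"
    by (rule conjugate_eq_0[OF PQ(1,2,4) mat_ad_carrier[OF H J]])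
  note diag = grading(2)[OF this]
  show ?thesis
    using diagonalizable_mat_ad_pow_eq_0[OF PQ J Y diag] nil unfolding A_eq by simp
qed

abbreviation emb :: "'a::field mat \<Rightarrow> 'a alg_closure mat" where
  "emb \<equiv> map_mat to_ac"

lemma emb_mat_ad:
  assumes "A \<in> carrier_mat n n" "Y \<in> carrier_mat n n"
  shows "emb (mat_ad A Y) = mat_ad (emb A) (emb Y)"
  using assms
  by (intro eq_matI) (auto simp: mat_ad_def scalar_prod_def to_ac_sum)

lemma emb_mat_ad_pow:
  assumes "A \<in> carrier_mat n n" "Y \<in> carrier_mat n n"
  shows "emb ((mat_ad A ^^ k) Y) = (mat_ad (emb A) ^^ k) (emb Y)"
  by (induction k) (simp_all add: emb_mat_ad[OF assms(1) mat_ad_pow_carrier[OF assms]])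

lemma emb_0 [simp]: "emb (0\<^sub>m n m) = 0\<^sub>m n m"
  by (intro eq_matI) simp_all

lemma emb_eq_0_iff:
  "Y \<in> carrier_mat n n \<Longrightarrow> emb Y = 0\<^sub>m n n \<longleftrightarrow> Y = 0\<^sub>m n n"
  by (auto simp: mat_eq_iff)

lemma index_mat_ad:
  assumes "A \<in> carrier_mat n n" "Y \<in> carrier_mat n n" "i < n" "j < n"
  shows "mat_ad A Y $$ (i,j) = (\<Sum>l<n. A $$ (i,l) * Y $$ (l,j)) - (\<Sum>l<n. Y $$ (i,l) * A $$ (l,j))"
  using assms by (simp add: mat_ad_def index_mult_mat_sum[of _ n n _ n] del: index_mult_mat(1))

lemma mat_ad_linear_combination:
  assumes A: "A \<in> carrier_mat n n" and Y: "Y \<in> carrier_mat n n" "Z \<in> carrier_mat n n"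
  shows "mat_ad A (c \<cdot>\<^sub>m Y + Z) = c \<cdot>\<^sub>m mat_ad A Y + mat_ad A Z"
proof (rule eq_matI)
  fix i j assume "i < dim_row (c \<cdot>\<^sub>m mat_ad A Y + mat_ad A Z)" "j < dim_col (c \<cdot>\<^sub>m mat_ad A Y + mat_ad A Z)"
  then have ij: "i < n" "j < n" using mat_ad_carrier[OF A Y(2)] by auto
  have "c \<cdot>\<^sub>m Y + Z \<in> carrier_mat n n" using Y by simp
  then show "mat_ad A (c \<cdot>\<^sub>m Y + Z) $$ (i,j) = (c \<cdot>\<^sub>m mat_ad A Y + mat_ad A Z) $$ (i,j)"
    using ij Y carrier_matD[OF mat_ad_carrier[OF A Y(1)]] carrier_matD[OF mat_ad_carrier[OF A Y(2)]]
    by (simp add: index_mat_ad[OF A] sum.distrib sum_distrib_left algebra_simps)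
qed (use carrier_matD[OF mat_ad_carrier[OF A Y(2)]] carrier_matD[OF mat_ad_carrier[OF A, of "c \<cdot>\<^sub>m Y + Z"]] Y in simp_all)

lemma mat_ad_pow_linear_combination:
  assumes A: "A \<in> carrier_mat n n" and Y: "Y \<in> carrier_mat n n" "Z \<in> carrier_mat n n"
  shows "(mat_ad A ^^ k) (c \<cdot>\<^sub>m Y + Z) = c \<cdot>\<^sub>m (mat_ad A ^^ k) Y + (mat_ad A ^^ k) Z"
  by (induction k)
    (simp_all add: mat_ad_linear_combination[OF A mat_ad_pow_carrier[OF A Y(1)] mat_ad_pow_carrier[OF A Y(2)]])

lemma mat_ad_pencil_polynomial:
  fixes M N C :: "'a::comm_ring_1 mat"
  assumes MN: "M \<in> carrier_mat n n" "N \<in> carrier_mat n n" and C: "C \<in> carrier_mat n n"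
  shows "\<exists>p. \<forall>t i j. i < n \<longrightarrow> j < n \<longrightarrow> (mat_ad (M + t \<cdot>\<^sub>m N) ^^ k) C $$ (i,j) = poly (p i j) t"
proof (induction k)
  case 0
  show ?case by (intro exI[of _ "\<lambda>i j. [:C $$ (i,j):]"]) simp
next
  case (Suc k)
  then obtain p where p: "\<And>t i j. i < n \<Longrightarrow> j < n \<Longrightarrow> (mat_ad (M + t \<cdot>\<^sub>m N) ^^ k) C $$ (i,j) = poly (p i j) t"
    by blast
  \<comment> \<open>entry \<open>(i,j)\<close> of the pencil \<open>M + t N\<close> as a polynomial in \<open>t\<close>\<close>
  let ?q = "\<lambda>i j. [:M $$ (i,j), N $$ (i,j):]"
  have "(mat_ad (M + t \<cdot>\<^sub>m N) ^^ Suc k) C $$ (i,j)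
      = poly ((\<Sum>l<n. ?q i l * p l j) - (\<Sum>l<n. p i l * ?q l j)) t" if ij: "i < n" "j < n" for t i j
  proof -
    have L: "M + t \<cdot>\<^sub>m N \<in> carrier_mat n n" using MN by simp
    have "(M + t \<cdot>\<^sub>m N) $$ (i',j') = poly (?q i' j') t" if "i' < n" "j' < n" for i' j'
      using MN that by simp
    then show ?thesis
      using index_mat_ad[OF L mat_ad_pow_carrier[OF L C] ij, of k] ij
      by (simp add: p poly_sum algebra_simps sum.distrib)
  qed
  then show ?case
    by (intro exI[of _ "\<lambda>i j. (\<Sum>l<n. ?q i l * p l j) - (\<Sum>l<n. p i l * ?q l j)"] allI impI)
qed

text \<open>
  Expand the entries of \<open>Y\<close> in a basis of the closure over the base field: \<open>Y = \<Sum>b. b Y\<^sub>b\<close> with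
  rational matrices \<open>Y\<^sub>b\<close> that lie in the kernel again, as taking coordinates is linear. Replace the
  rational scalars by the elements \<open>b\<close> one at a time: \<open>Z\<close> consists of the matrices whose translates
  by all rational kernel elements annihilate \<open>B\<close>, and \<open>Z\<close> is stable under adding \<open>c w\<close> with \<open>w\<close> in the kernel and
  \<open>c\<close> in the closure, since a polynomial in \<open>c\<close> that vanishes on the infinite base field is zero.
\<close>

lemma kernel_in_annihilator_alg_closure:
  fixes A B :: "'a::field_char_0 mat"
  assumes A: "A \<in> carrier_mat n n" and B: "B \<in> carrier_mat n n"
    and sub: "\<And>Y. Y \<in> carrier_mat n n \<Longrightarrow> (mat_ad A ^^ k) Y = 0\<^sub>m n n \<Longrightarrow> (mat_ad Y ^^ l) B = 0\<^sub>m n n"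
    and Y: "Y \<in> carrier_mat n n" and nil: "(mat_ad (emb A) ^^ k) Y = 0\<^sub>m n n"
  shows "(mat_ad Y ^^ l) (emb B) = 0\<^sub>m n n"
proof -
  define W where "W = {w \<in> carrier_mat n n. (mat_ad A ^^ k) w = 0\<^sub>m n n}"
  define Z where "Z = {U \<in> carrier_mat n n. \<forall>w\<in>W. (mat_ad (U + emb w) ^^ l) (emb B) = 0\<^sub>m n n}"
  have step: "U + c \<cdot>\<^sub>m emb w \<in> Z" if U: "U \<in> Z" and w: "w \<in> W" for U w c
  proof -
    have Uc: "U \<in> carrier_mat n n" and wc: "w \<in> carrier_mat n n" using U w by (auto simp: Z_def W_def)
    have "(mat_ad (U + c \<cdot>\<^sub>m emb w + emb w') ^^ l) (emb B) = 0\<^sub>m n n" if w': "w' \<in> W" for w'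
    proof -
      have w'c: "w' \<in> carrier_mat n n" using w' by (simp add: W_def)
      let ?M = "U + emb w'"
      have M: "?M \<in> carrier_mat n n" "emb w \<in> carrier_mat n n" "emb B \<in> carrier_mat n n"
        using Uc w'c wc B by auto
      obtain p where p: "\<And>t i j. i < n \<Longrightarrow> j < n \<Longrightarrow> (mat_ad (?M + t \<cdot>\<^sub>m emb w) ^^ l) (emb B) $$ (i,j) = poly (p i j) t"
        using mat_ad_pencil_polynomial[OF M, of l] by blast
      have "poly (p i j) (to_ac s) = 0" if ij: "i < n" "j < n" for i j s
      proof -
        have "s \<cdot>\<^sub>m w + w' \<in> W"
          using w w' by (simp add: W_def mat_ad_pow_linear_combination[OF A])
        then have "(mat_ad (U + emb (s \<cdot>\<^sub>m w + w')) ^^ l) (emb B) = 0\<^sub>m n n"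
          using U by (simp add: Z_def)
        also have "U + emb (s \<cdot>\<^sub>m w + w') = ?M + to_ac s \<cdot>\<^sub>m emb w"
          using Uc wc w'c by (intro eq_matI) auto
        finally show ?thesis using p[OF ij, of "to_ac s"] ij by simp
      qed
      then have "range to_ac \<subseteq> {t. poly (p i j) t = 0}" if "i < n" "j < n" for i j
        using that by auto
      moreover have "infinite (range (to_ac :: 'a \<Rightarrow> _))"
        using finite_imageD[OF _ inj_to_ac] infinite_UNIV_char_0[where ?'a = 'a] by blast
      ultimately have "p i j = 0" if "i < n" "j < n" for i j
        using that poly_roots_finite[of "p i j"] finite_subset by blast
      then have "(mat_ad (?M + c \<cdot>\<^sub>m emb w) ^^ l) (emb B) = 0\<^sub>m n n"
        using p M by (intro eq_matI) (auto simp: carrier_matD[OF mat_ad_pow_carrier[of "?M + c \<cdot>\<^sub>m emb w" n]])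
      also have "?M + c \<cdot>\<^sub>m emb w = U + c \<cdot>\<^sub>m emb w + emb w'"
        using Uc wc w'c by (intro eq_matI) auto
      finally show ?thesis .
    qed
    then show ?thesis using Uc wc by (simp add: Z_def)
  qed
  \<comment> \<open>coordinates of the closure as a vector space over the base field\<close>
  interpret ac: vector_space "\<lambda>(c::'a) x. to_ac c * x"
    by unfold_locales (simp_all add: algebra_simps)
  obtain Bs where Bs: "ac.independent Bs" "ac.span Bs = UNIV"
    using ac.independent_extend_basis[OF ac.independent_empty] ac.span_extend_basis[OF ac.independent_empty] by blast
  define rep where "rep x b = ac.representation Bs x b" for x b
  have rep_sum: "rep (\<Sum>i\<in>I. f i) b = (\<Sum>i\<in>I. rep (f i) b)" for I :: "nat set" and f b
    using Bs by (simp add: rep_def ac.representation_sum)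
  have rep_diff: "rep (x - y) b = rep x b - rep y b" for x y b
    using Bs by (simp add: rep_def ac.representation_diff)
  have rep_scale: "rep (to_ac c * x) b = c * rep x b" for c x b
    using Bs by (simp add: rep_def ac.representation_scale)
  have rep_0: "rep 0 b = 0" for b
    using ac.representation_zero[of Bs] by (simp add: rep_def)
  have x_eq: "x = (\<Sum>b | rep x b \<noteq> 0. to_ac (rep x b) * b)" for x
    using ac.sum_nonzero_representation_eq[OF Bs(1), of x] Bs(2) by (simp add: rep_def)
  have fin: "finite {b. rep x b \<noteq> 0}" for x
    using ac.finite_representation[of Bs x] by (simp add: rep_def)
  \<comment> \<open>the rational matrix \<open>Y\<^sub>b\<close>\<close>
  define comp where "comp b U = map_mat (\<lambda>x. rep x b) U" for b U
  have comp_dim: "dim_row (comp b U) = dim_row U" "dim_col (comp b U) = dim_col U" for b U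
    by (simp_all add: comp_def)
  have comp_ad: "comp b (mat_ad (emb A) U) = mat_ad A (comp b U)" if "U \<in> carrier_mat n n" for b U
  proof (rule eq_matI)
    have c: "emb A \<in> carrier_mat n n" "comp b U \<in> carrier_mat n n" using A that by (auto simp: comp_def)
    note d = carrier_matD[OF mat_ad_carrier[OF A c(2)]] carrier_matD[OF mat_ad_carrier[OF c(1) that]]
    show "dim_row (comp b (mat_ad (emb A) U)) = dim_row (mat_ad A (comp b U))"
      "dim_col (comp b (mat_ad (emb A) U)) = dim_col (mat_ad A (comp b U))"
      by (simp_all only: d comp_dim)
    fix i j assume "i < dim_row (mat_ad A (comp b U))" "j < dim_col (mat_ad A (comp b U))"
    then have ij: "i < n" "j < n" by (simp_all add: d)
    have "comp b (mat_ad (emb A) U) $$ (i,j) = rep (mat_ad (emb A) U $$ (i,j)) b"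
      using ij by (simp add: comp_def d)
    also have "\<dots> = (\<Sum>l<n. A $$ (i,l) * rep (U $$ (l,j)) b) - (\<Sum>l<n. A $$ (l,j) * rep (U $$ (i,l)) b)"
      using ij A by (simp add: index_mat_ad[OF c(1) that] rep_diff rep_sum rep_scale mult.commute[of _ "to_ac _"])
    also have "\<dots> = mat_ad A (comp b U) $$ (i,j)"
      unfolding index_mat_ad[OF A c(2) ij] using ij that by (simp add: comp_def mult.commute)
    finally show "comp b (mat_ad (emb A) U) $$ (i,j) = mat_ad A (comp b U) $$ (i,j)" .
  qed
  have comp_0: "comp b (0\<^sub>m n n) = 0\<^sub>m n n" for b
    by (intro eq_matI) (auto simp: comp_def rep_0)
  have comp_ad_pow: "comp b ((mat_ad (emb A) ^^ i) Y) = (mat_ad A ^^ i) (comp b Y)" for b i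
    by (induction i) (use A Y in \<open>simp_all add: comp_ad\<close>)
  have "(mat_ad A ^^ k) (comp b Y) = 0\<^sub>m n n" for b
    using comp_ad_pow[of b k] comp_0 nil by simp
  then have comp_W: "comp b Y \<in> W" for b using Y by (simp add: W_def comp_def)
  \<comment> \<open>a partial sum of the expansion of \<open>Y\<close>\<close>
  define part where "part S = mat n n (\<lambda>(i,j). \<Sum>b\<in>S. to_ac (rep (Y $$ (i,j)) b) * b)" for S
  have "part S \<in> Z" if "finite S" for S
    using that
  proof (induction S)
    case empty
    have "(mat_ad (part {} + emb w) ^^ l) (emb B) = 0\<^sub>m n n" if "w \<in> W" for w
    proof -
      have w: "w \<in> carrier_mat n n" "(mat_ad w ^^ l) B = 0\<^sub>m n n" using that sub by (auto simp: W_def)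
      have "part {} + emb w = emb w" using w(1) by (intro eq_matI) (auto simp: part_def)
      then show ?thesis using emb_mat_ad_pow[OF w(1) B, of l] w(2) by simp
    qed
    then show ?case by (simp add: Z_def part_def)
  next
    case (insert b S)
    have "part (insert b S) = part S + b \<cdot>\<^sub>m emb (comp b Y)"
      using insert.hyps Y by (intro eq_matI) (auto simp: part_def comp_def algebra_simps)
    then show ?case using step[OF insert.IH comp_W] by simp
  qed
  moreover define S where "S = (\<Union>i<n. \<Union>j<n. {b. rep (Y $$ (i,j)) b \<noteq> 0})"
  ultimately have "part S \<in> Z" using fin by simp
  moreover have "part S = Y"
  proof (rule eq_matI)
    fix i j assume "i < dim_row Y" "j < dim_col Y"
    then have ij: "i < n" "j < n" using Y by auto
    have "(\<Sum>b | rep (Y $$ (i,j)) b \<noteq> 0. to_ac (rep (Y $$ (i,j)) b) * b)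
       = (\<Sum>b\<in>S. to_ac (rep (Y $$ (i,j)) b) * b)"
      using ij fin by (intro sum.mono_neutral_left) (auto simp: S_def)
    then show "part S $$ (i,j) = Y $$ (i,j)"
      using ij x_eq[of "Y $$ (i,j)"] by (simp add: part_def)
  qed (use Y in \<open>auto simp: part_def\<close>)
  moreover have "0\<^sub>m n n \<in> W" using A by (simp add: W_def)
  ultimately have "(mat_ad (Y + emb (0\<^sub>m n n)) ^^ l) (emb B) = 0\<^sub>m n n" by (auto simp: Z_def)
  moreover have "Y + emb (0\<^sub>m n n) = Y" using Y by (intro eq_matI) auto
  ultimately show ?thesis by simp
qed

lemma ker_mat_ad_pow_1: "A \<in> carrier_mat n n \<Longrightarrow> ker_mat_ad_pow n 1 A = mat_centralizer n A"
  by (auto simp: ker_mat_ad_pow_def mat_centralizer_def mat_ad_eq_0_iff)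

lemma mat_annihilator_1: "B \<in> carrier_mat n n \<Longrightarrow> mat_annihilator n 1 B = mat_centralizer n B"
  by (auto simp: mat_annihilator_def mat_centralizer_def mat_ad_eq_0_iff)

lemma ker_mat_ad_pow_eq_centralizer:
  fixes A B :: "'a::field_char_0 mat"
  assumes A: "A \<in> carrier_mat n n" and B: "B \<in> carrier_mat n n"
    and kl: "k \<ge> 2" "l \<ge> 1"
    and AB: "ker_mat_ad_pow n k A = mat_annihilator n k B"
    and BA: "ker_mat_ad_pow n l B = mat_annihilator n l A"
  shows "ker_mat_ad_pow n k A \<subseteq> mat_centralizer n A"
proof
  fix Y assume "Y \<in> ker_mat_ad_pow n k A"
  then have Y: "Y \<in> carrier_mat n n" and nil: "(mat_ad A ^^ k) Y = 0\<^sub>m n n"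
    by (auto simp: ker_mat_ad_pow_def)
  have eA: "emb A \<in> carrier_mat n n" and eB: "emb B \<in> carrier_mat n n" and eY: "emb Y \<in> carrier_mat n n"
    using A B Y by auto
  have subA: "(mat_ad U ^^ k) B = 0\<^sub>m n n" if "U \<in> carrier_mat n n" "(mat_ad A ^^ k) U = 0\<^sub>m n n" for U
    using AB that by (auto simp: ker_mat_ad_pow_def mat_annihilator_def)
  have subB: "(mat_ad U ^^ l) A = 0\<^sub>m n n" if "U \<in> carrier_mat n n" "(mat_ad B ^^ l) U = 0\<^sub>m n n" for U
    using BA that by (auto simp: ker_mat_ad_pow_def mat_annihilator_def)
  have "(mat_ad (emb A) ^^ k) (emb Y) = 0\<^sub>m n n"
    using emb_mat_ad_pow[OF A Y, of k] nil by simp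
  then have "mat_ad (emb A) (emb Y) = 0\<^sub>m n n"
    using kernel_in_annihilator_alg_closure[OF A B subA] kernel_in_annihilator_alg_closure[OF B A subB]
    by (intro semisimple_of_kernels_in_annihilators[OF eA eB _ _ kl eY])
  then have "emb (mat_ad A Y) = 0\<^sub>m n n" by (simp add: emb_mat_ad[OF A Y])
  then have "mat_ad A Y = 0\<^sub>m n n" using emb_eq_0_iff[OF mat_ad_carrier[OF A Y]] by simp
  then show "Y \<in> mat_centralizer n A"
    using Y by (simp add: mat_centralizer_def mat_ad_eq_0_iff[OF A Y])
qed

lemma centralizer_le_annihilator:
  assumes B: "B \<in> carrier_mat n n" and "k \<ge> 1"
  shows "mat_centralizer n B \<subseteq> mat_annihilator n k B"
proof
  fix Y assume "Y \<in> mat_centralizer n B"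
  then have Y: "Y \<in> carrier_mat n n" and "(mat_ad Y ^^ 1) B = 0\<^sub>m n n"
    using B by (auto simp: mat_centralizer_def mat_ad_eq_0_iff)
  then show "Y \<in> mat_annihilator n k B"
    using mat_ad_pow_eq_0_mono[OF Y, of 1 B k] assms(2) by (simp add: mat_annihilator_def)
qed

lemma centralizer_eq_iff_kernels_eq_annihilators:
  fixes A B :: "'a::field_char_0 mat"
  assumes A: "A \<in> carrier_mat n n" and B: "B \<in> carrier_mat n n"
  shows "mat_centralizer n A = mat_centralizer n B \<longleftrightarrow>
       (\<exists>k\<^sub>1 k\<^sub>2 :: nat. k\<^sub>1 > 0 \<and> k\<^sub>2 > 0 \<and>
          ker_mat_ad_pow n k\<^sub>1 A = mat_annihilator n k\<^sub>1 B \<and>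
          ker_mat_ad_pow n k\<^sub>2 B = mat_annihilator n k\<^sub>2 A)"
proof
  assume "mat_centralizer n A = mat_centralizer n B"
  then show "\<exists>k\<^sub>1 k\<^sub>2 :: nat. k\<^sub>1 > 0 \<and> k\<^sub>2 > 0 \<and>
          ker_mat_ad_pow n k\<^sub>1 A = mat_annihilator n k\<^sub>1 B \<and>
          ker_mat_ad_pow n k\<^sub>2 B = mat_annihilator n k\<^sub>2 A"
    using A B by (intro exI[of _ 1]) (simp only: ker_mat_ad_pow_1 mat_annihilator_1, simp)
next
  assume "\<exists>k\<^sub>1 k\<^sub>2 :: nat. k\<^sub>1 > 0 \<and> k\<^sub>2 > 0 \<and>
          ker_mat_ad_pow n k\<^sub>1 A = mat_annihilator n k\<^sub>1 B \<and>
          ker_mat_ad_pow n k\<^sub>2 B = mat_annihilator n k\<^sub>2 A"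
  then obtain k l :: nat where kl: "k \<ge> 1" "l \<ge> 1"
    and AB: "ker_mat_ad_pow n k A = mat_annihilator n k B"
    and BA: "ker_mat_ad_pow n l B = mat_annihilator n l A"
    by (auto simp: Suc_le_eq)
  consider "k = 1" | "l = 1" | "k \<ge> 2" "l \<ge> 2" using kl by linarith
  then show "mat_centralizer n A = mat_centralizer n B"
  proof cases
    case 1
    then show ?thesis using AB ker_mat_ad_pow_1[OF A] mat_annihilator_1[OF B] by simp
  next
    case 2
    then show ?thesis using BA ker_mat_ad_pow_1[OF B] mat_annihilator_1[OF A] by simp
  next
    case 3
    have "mat_centralizer n B \<subseteq> mat_centralizer n A"
      using centralizer_le_annihilator[OF B kl(1)] ker_mat_ad_pow_eq_centralizer[OF A B 3(1) kl(2) AB BA] AB by blast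
    moreover have "mat_centralizer n A \<subseteq> mat_centralizer n B"
      using centralizer_le_annihilator[OF A kl(2)] ker_mat_ad_pow_eq_centralizer[OF B A 3(2) kl(1) BA AB] BA by blast
    ultimately show ?thesis by blast
  qed
qed

section \<open>The equivalences\<close>

theorem theorem4p3:
  fixes A B :: "'a::field_char_0 mat" and n :: nat
  assumes "n \<ge> 1" and "A \<in> carrier_mat n n" and "B \<in> carrier_mat n n"
  shows
    "(mat_centralizer n A = mat_centralizer n B \<longleftrightarrow>
       (\<exists>f g :: 'a poly. degree f \<le> n - 1 \<and> degree g \<le> n - 1 \<and>
          A = mat_poly f B \<and> B = mat_poly g A)) \<and>
     (mat_centralizer n A = mat_centralizer n B \<longleftrightarrow>
       (\<exists>P \<in> carrier_mat (n\<^sup>2) (n\<^sup>2). invertible_mat P \<and>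
          1\<^sub>m n \<otimes>\<^sub>k A - A\<^sup>T \<otimes>\<^sub>k 1\<^sub>m n
            = P * (1\<^sub>m n \<otimes>\<^sub>k B - B\<^sup>T \<otimes>\<^sub>k 1\<^sub>m n))) \<and>
     (mat_centralizer n A = mat_centralizer n B \<longleftrightarrow>
       (\<exists>k\<^sub>1 k\<^sub>2 :: nat. k\<^sub>1 > 0 \<and> k\<^sub>2 > 0 \<and>
          ker_mat_ad_pow n k\<^sub>1 A = mat_annihilator n k\<^sub>1 B \<and>
          ker_mat_ad_pow n k\<^sub>2 B = mat_annihilator n k\<^sub>2 A))"
  using centralizer_eq_iff_mutual_polys[OF assms(2,3,1)]
    centralizer_eq_iff_left_equivalent[OF assms(2,3)]
    centralizer_eq_iff_kernels_eq_annihilators[OF assms(2,3)]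
  by (intro conjI)

end
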